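(* Let $a_1,\ldots,a_n\in\mathbb R^d$ be orthonormal vectors and let $T\in(\mathbb R^d)^{\otimes3}$ be a symmetric $3$-tensor with $\|T-\sum_i a_i^{\otimes3}\|_{\{1\},\{2,3\}}\le\tau$. Let $g$ be a standard $d$-dimensional Gaussian vector and let $\delta\in[0,1]$. Then, with probability at least $1/(d^{1+\delta}(\log d)^{O(1)})$ over the choice of $g$, the top eigenvector of the $d\times d$ matrix \[ M_g=(\mathrm{Id}\otimes\mathrm{Id}\otimes g^{\mathsf T})T \] is $O(\tau/\delta)$-close to $a_1$, and at the same time the ratio between the top eigenvalue of $M_g$ and its second largest eigenvalue in absolute value is at least $1+\delta/3-O(\tau)$.
   Context: $(\mathrm{Id}\otimes\mathrm{Id}\otimes g^{\mathsf T})T=\sum_{i,j,k}T_{ijk}g_ke_i\otimes e_j$ is the contraction of the third mode of $T$ with $g$. $\|T\|_{\{1\},\{2,3\}}$ is the spectral norm of $T$ viewed as a $d\times d^2$ matrix (first mode indexing rows). A tensor is symmetric if its entries are invariant under permutations of indices. $O(\cdot)$ hides absolute constants. *)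

theory Defs
  imports "HOL-Probability.Probability" "Jordan_Normal_Form.Char_Poly"
begin

unbundle no inner_syntax and no vec_syntax

text \<open>
  Constants in the theorem must not depend on the dimension, so the dimension \<open>d\<close> is a
  natural number. Vectors and matrices are those of \<open>Jordan_Normal_Form\<close>; a tensor in
  \<open>(\<real>\<^sup>d)\<^sup>\<otimes>\<^sup>3\<close> is a function of three indices, only the entries with all indices below \<open>d\<close>
  being relevant.
\<close>

type_synonym tensor3 = "nat \<Rightarrow> nat \<Rightarrow> nat \<Rightarrow> real"

definition symmetric_tensor3 :: "nat \<Rightarrow> tensor3 \<Rightarrow> bool" where
  "symmetric_tensor3 d T \<longleftrightarrow> (\<forall>i<d. \<forall>j<d. \<forall>k<d.
     T i j k = T i k j \<and> T i j k = T j i k \<and> T i j k = T j k i \<and>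
     T i j k = T k i j \<and> T i j k = T k j i)"

definition cube_tensor :: "real Matrix.vec \<Rightarrow> tensor3" where
  "cube_tensor a = (\<lambda>i j k. a $ i * a $ j * a $ k)"

definition euclid_norm :: "real Matrix.vec \<Rightarrow> real" where
  "euclid_norm v = sqrt (v \<bullet> v)"

definition orthonormal_family :: "nat \<Rightarrow> nat set \<Rightarrow> (nat \<Rightarrow> real Matrix.vec) \<Rightarrow> bool" where
  "orthonormal_family d I a \<longleftrightarrow>
     (\<forall>i\<in>I. a i \<in> carrier_vec d) \<and>
     (\<forall>i\<in>I. \<forall>j\<in>I. a i \<bullet> a j = (if i = j then 1 else 0))"

definition spectral_norm :: "real Matrix.mat \<Rightarrow> real" where
  "spectral_norm A =
     Sup {euclid_norm (A *\<^sub>v x) | x. x \<in> carrier_vec (dim_col A) \<and> euclid_norm x \<le> 1}"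

text \<open>The column index \<open>j * d + k\<close> stands for the pair \<open>(j, k)\<close> of the second and third mode.\<close>

definition flatten_1_23 :: "nat \<Rightarrow> tensor3 \<Rightarrow> real Matrix.mat" where
  "flatten_1_23 d T = Matrix.mat d (d * d) (\<lambda>(i, l). T i (l div d) (l mod d))"

definition contract3 :: "nat \<Rightarrow> tensor3 \<Rightarrow> (nat \<Rightarrow> real) \<Rightarrow> real Matrix.mat" where
  "contract3 d T g = Matrix.mat d d (\<lambda>(i, j). \<Sum>k<d. T i j k * g k)"

definition std_gaussian :: "nat \<Rightarrow> (nat \<Rightarrow> real) measure" where
  "std_gaussian d = PiM {..<d} (\<lambda>_. density lborel std_normal_density)"

text \<open>
  Real eigenvalues with algebraic multiplicity; the notions below are meant for real symmetric
  matrices, for which these are all the eigenvalues.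
\<close>

definition eigenvalues :: "real Matrix.mat \<Rightarrow> real multiset" where
  "eigenvalues A = proots (char_poly A)"

definition top_eigenvalue :: "real Matrix.mat \<Rightarrow> real" where
  "top_eigenvalue A = Max (set_mset (eigenvalues A))"

text \<open>
  Only one copy of the top eigenvalue is removed, so a multiple top eigenvalue is also the
  second one.
\<close>

definition second_abs_eigenvalue :: "real Matrix.mat \<Rightarrow> real" where
  "second_abs_eigenvalue A =
     Max (abs ` set_mset (eigenvalues A - {#top_eigenvalue A#}))"

definition top_eigenvector :: "real Matrix.mat \<Rightarrow> real Matrix.vec \<Rightarrow> bool" where
  "top_eigenvector A v \<longleftrightarrow> eigenvector A v (top_eigenvalue A) \<and> euclid_norm v = 1"

text \<open>A unit eigenvector is determined only up to sign, hence so is its distance to a vector.\<close>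

definition dist_up_to_sign :: "real Matrix.vec \<Rightarrow> real Matrix.vec \<Rightarrow> real" where
  "dist_up_to_sign v a = min (euclid_norm (v - a)) (euclid_norm (v + a))"

end

theory Submission
  imports Defs "HOL-Real_Asymp.Real_Asymp"
begin

text \<open>
  Write \<open>E = T - \<Sum>\<^sub>i a\<^sub>i\<^sup>\<otimes>\<^sup>3\<close> and \<open>E\<^sub>g\<close> for its contraction with \<open>g\<close>, so that
  \<open>M\<^sub>g = \<Sum>\<^sub>i \<langle>g, a\<^sub>i\<rangle> a\<^sub>i a\<^sub>i\<^sup>T + E\<^sub>g\<close>.
  The flattening bound says that the slices satisfy \<open>\<Sum>\<^sub>k E\<^sub>k\<^sup>2 \<le> \<tau>\<^sup>2 Id\<close>. Gaussian integration by parts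
  together with \<open>tr (H X\<^sup>q H X\<^sup>r) \<le> tr (H\<^sup>2 X\<^sup>q\<^sup>+\<^sup>r)\<close> for even \<open>q + r\<close> then bounds the moments of the
  trace, \<open>\<E> tr E\<^sub>g\<^sup>2\<^sup>m \<le> d (2 m \<tau>\<^sup>2)\<^sup>m\<close>, and \<open>m \<approx> log d\<close> gives \<open>\<parallel>E\<^sub>g\<parallel> = O(\<tau> sqrt (log d))\<close> with
  high probability.

  Put \<open>s = sqrt (2 log (16 d))\<close> and \<open>t = sqrt (1 + \<delta>) s\<close>. With probability of order \<open>1 / s\<close> one has
  \<open>0 \<le> \<langle>g, a\<^sub>1\<rangle> \<le> 1 / t\<close>, \<open>\<bar>\<langle>g, a\<^sub>i\<rangle>\<bar> \<le> s\<close> for \<open>i \<noteq> 1\<close>, and the norm bound. Translating this event by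
  \<open>t a\<^sub>1\<close> costs a factor \<open>exp (- 1 - t\<^sup>2 / 2)\<close>, which is of order \<open>d\<^sup>-\<^sup>1\<^sup>-\<^sup>\<delta>\<close>, and after the translation
  \<open>\<langle>g, a\<^sub>1\<rangle> \<ge> t\<close> exceeds all other coefficients by the factor \<open>sqrt (1 + \<delta>) \<ge> 1 + \<delta> / 3\<close>, while
  \<open>\<parallel>E\<^sub>g\<parallel>\<close> is still \<open>O(\<tau> s)\<close>. The claims about eigenvalues and eigenvectors follow by the
  perturbation arguments of Weyl and of Davis and Kahan.
\<close>

section \<open>Finite-dimensional linear algebra in coordinates\<close>

text \<open>Vectors are functions of which only the entries below \<open>d\<close> count, so that
  Gaussian samples, eigenvectors and the \<open>a l\<close> share one type without carrier
  conditions.\<close>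

definition ip :: "nat \<Rightarrow> (nat \<Rightarrow> real) \<Rightarrow> (nat \<Rightarrow> real) \<Rightarrow> real" where
  "ip d x y = (\<Sum>i<d. x i * y i)"

definition mv :: "nat \<Rightarrow> (nat \<Rightarrow> nat \<Rightarrow> real) \<Rightarrow> (nat \<Rightarrow> real) \<Rightarrow> nat \<Rightarrow> real" where
  "mv d S x = (\<lambda>i. \<Sum>j<d. S i j * x j)"

definition orthonormal_on :: "nat \<Rightarrow> 'i set \<Rightarrow> ('i \<Rightarrow> nat \<Rightarrow> real) \<Rightarrow> bool" where
  "orthonormal_on d I u \<longleftrightarrow> (\<forall>i\<in>I. \<forall>j\<in>I. ip d (u i) (u j) = (if i = j then 1 else 0))"

definition symmetric_on :: "nat \<Rightarrow> (nat \<Rightarrow> nat \<Rightarrow> real) \<Rightarrow> bool" where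
  "symmetric_on d S \<longleftrightarrow> (\<forall>i<d. \<forall>j<d. S i j = S j i)"

lemma ip_commute: "ip d x y = ip d y x"
  by (simp add: ip_def mult.commute)

lemma ip_add_left: "ip d (\<lambda>i. x i + y i) z = ip d x z + ip d y z"
  by (simp add: ip_def algebra_simps sum.distrib)

lemma ip_diff_left: "ip d (\<lambda>i. x i - y i) z = ip d x z - ip d y z"
  by (simp add: ip_def algebra_simps sum_subtractf)

lemma ip_scale_left: "ip d (\<lambda>i. c * x i) z = c * ip d x z"
  by (simp add: ip_def algebra_simps sum_distrib_left)

lemma ip_sum_left: "ip d (\<lambda>i. \<Sum>k\<in>K. f k i) z = (\<Sum>k\<in>K. ip d (f k) z)"
  by (simp add: ip_def sum_distrib_right) (rule sum.swap)

lemma ip_add_right: "ip d z (\<lambda>i. x i + y i) = ip d z x + ip d z y"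
  by (simp add: ip_def algebra_simps sum.distrib)

lemma ip_diff_right: "ip d z (\<lambda>i. x i - y i) = ip d z x - ip d z y"
  by (simp add: ip_def algebra_simps sum_subtractf)

lemma ip_scale_right: "ip d z (\<lambda>i. c * x i) = c * ip d z x"
  by (simp add: ip_def algebra_simps sum_distrib_left)

lemma ip_sum_right: "ip d z (\<lambda>i. \<Sum>k\<in>K. f k i) = (\<Sum>k\<in>K. ip d z (f k))"
  by (simp add: ip_def sum_distrib_left) (rule sum.swap)

lemmas ip_linear = ip_add_left ip_diff_left ip_scale_left ip_sum_left
  ip_add_right ip_diff_right ip_scale_right ip_sum_right

lemma ip_cong: "(\<And>i. i < d \<Longrightarrow> x i = x' i) \<Longrightarrow> (\<And>i. i < d \<Longrightarrow> y i = y' i) \<Longrightarrow> ip d x y = ip d x' y'"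
  by (simp add: ip_def)

lemma ip_self_nonneg: "0 \<le> ip d x x"
  by (simp add: ip_def sum_nonneg)

lemma ip_self_eq_0_iff: "ip d x x = 0 \<longleftrightarrow> (\<forall>i<d. x i = 0)"
  unfolding ip_def by (subst sum_nonneg_eq_0_iff) auto

lemma ip_Cauchy_Schwarz: "(ip d x y)\<^sup>2 \<le> ip d x x * ip d y y"
  using Cauchy_Schwarz_ineq_sum[of x y "{..<d}"] by (simp add: ip_def power2_eq_square)

lemma mv_symmetric:
  assumes "symmetric_on d S"
  shows "ip d (mv d S x) y = ip d x (mv d S y)"
proof -
  have "ip d (mv d S x) y = (\<Sum>i<d. \<Sum>j<d. S i j * x j * y i)"
    by (simp add: ip_def mv_def sum_distrib_right)
  also have "\<dots> = (\<Sum>j<d. \<Sum>i<d. S i j * x j * y i)"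
    by (rule sum.swap)
  also have "\<dots> = ip d x (mv d S y)"
    using assms unfolding ip_def mv_def sum_distrib_left symmetric_on_def
    by (intro sum.cong refl) (auto simp: algebra_simps)
  finally show ?thesis .
qed

section \<open>Projections along orthonormal families\<close>

lemma orthonormal_onD:
  "orthonormal_on d I u \<Longrightarrow> i \<in> I \<Longrightarrow> j \<in> I \<Longrightarrow> ip d (u i) (u j) = (if i = j then 1 else 0)"
  by (simp add: orthonormal_on_def)

text \<open>For orthonormal \<open>u\<close> this is the component of \<open>x\<close> orthogonal to
  their span.\<close>

definition residual :: "nat \<Rightarrow> 'i set \<Rightarrow> ('i \<Rightarrow> nat \<Rightarrow> real) \<Rightarrow> (nat \<Rightarrow> real) \<Rightarrow> nat \<Rightarrow> real" where
  "residual d I u x = (\<lambda>j. x j - (\<Sum>i\<in>I. ip d x (u i) * u i j))"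

lemma residual_orthogonal:
  assumes "finite I" "orthonormal_on d I u" "k \<in> I"
  shows "ip d (residual d I u x) (u k) = 0"
proof -
  have "(\<Sum>i\<in>I. ip d x (u i) * ip d (u i) (u k)) = (\<Sum>i\<in>I. if i = k then ip d x (u k) else 0)"
    using assms by (intro sum.cong) (auto simp: orthonormal_onD)
  then show ?thesis
    using assms by (simp add: residual_def ip_linear)
qed

lemma ip_residual_self:
  assumes "finite I" "orthonormal_on d I u"
  shows "ip d (residual d I u x) (residual d I u x) = ip d x x - (\<Sum>i\<in>I. (ip d x (u i))\<^sup>2)"
proof -
  let ?r = "residual d I u x"
  have "ip d ?r ?r = ip d ?r x - (\<Sum>i\<in>I. ip d x (u i) * ip d ?r (u i))"
    by (subst (2) residual_def) (simp add: ip_linear)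
  also have "\<dots> = ip d ?r x"
    using assms by (simp add: residual_orthogonal)
  also have "\<dots> = ip d x x - (\<Sum>i\<in>I. (ip d x (u i))\<^sup>2)"
    by (simp add: residual_def ip_linear power2_eq_square ip_commute[of d x "u _"])
  finally show ?thesis .
qed

lemma Bessel_inequality:
  assumes "finite I" "orthonormal_on d I u"
  shows "(\<Sum>i\<in>I. (ip d x (u i))\<^sup>2) \<le> ip d x x"
  using ip_residual_self[OF assms, of x] ip_self_nonneg[of d "residual d I u x"] by linarith

text \<open>The left side is the trace of the projection onto the orthogonal complement of the span.
  It yields three facts: an orthonormal family has at most \<open>d\<close> members, a smaller one
  leaves some unit vector outside its span, and one with \<open>d\<close> members is
  complete.\<close>

lemma sum_residual_unit_vectors:
  assumes "finite I" "orthonormal_on d I u"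
  shows "(\<Sum>j<d. ip d (residual d I u (\<lambda>k. if k = j then 1 else 0))
                     (residual d I u (\<lambda>k. if k = j then 1 else 0))) = real d - real (card I)"
proof -
  have unit: "ip d (\<lambda>k. if k = j then 1 else 0) x = x j" if "j < d" for j x
    using that by (simp add: ip_def if_distrib[of "\<lambda>z. z * _"] cong: if_cong)
  have "(\<Sum>j<d. \<Sum>i\<in>I. (u i j)\<^sup>2) = (\<Sum>i\<in>I. ip d (u i) (u i))"
    by (subst sum.swap) (simp add: ip_def power2_eq_square)
  also have "\<dots> = real (card I)"
    using assms by (simp add: orthonormal_onD)
  finally show ?thesis
    by (simp add: ip_residual_self[OF assms] sum_subtractf unit)
qed

lemma card_orthonormal_le:
  assumes "finite I" "orthonormal_on d I u"
  shows "card I \<le> d"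
proof -
  have "0 \<le> real d - real (card I)"
    unfolding sum_residual_unit_vectors[OF assms, symmetric]
    by (intro sum_nonneg ip_self_nonneg)
  then show ?thesis by simp
qed

lemma orthonormal_expansion:
  assumes "orthonormal_on d {..<d} u" "j < d"
  shows "x j = (\<Sum>i<d. ip d x (u i) * u i j)"
proof -
  let ?e = "\<lambda>j k. if k = j then 1 else 0 :: real"
  \<comment> \<open>The trace of the complementary projection is \<open>d - d = 0\<close>, so each
    of its nonnegative terms vanishes.\<close>
  have "ip d (residual d {..<d} u (?e l)) (residual d {..<d} u (?e l)) = 0" if "l < d" for l
    using sum_residual_unit_vectors[OF finite_lessThan assms(1)] that
    by (subst (asm) card_lessThan, subst (asm) diff_self, subst (asm) sum_nonneg_eq_0_iff)
       (auto intro: ip_self_nonneg)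
  then have *: "?e l j = (\<Sum>i<d. u i l * u i j)" if "l < d" for l
    using that assms(2) unfolding ip_self_eq_0_iff
    by (auto simp: residual_def ip_def if_distrib[of "\<lambda>z. z * _"] cong: if_cong)
  have "x j = (\<Sum>l<d. x l * ?e l j)"
    using assms(2) by (simp add: if_distrib[of "\<lambda>z. _ * z"] cong: if_cong)
  also have "\<dots> = (\<Sum>l<d. \<Sum>i<d. x l * u i l * u i j)"
    by (intro sum.cong refl, subst *) (auto simp: sum_distrib_left mult.assoc)
  also have "\<dots> = (\<Sum>i<d. ip d x (u i) * u i j)"
    by (subst sum.swap) (simp add: ip_def sum_distrib_right)
  finally show ?thesis .
qed

lemma Parseval:
  assumes "orthonormal_on d {..<d} u"
  shows "ip d x y = (\<Sum>i<d. ip d x (u i) * ip d y (u i))"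
proof -
  have "ip d x y = ip d (\<lambda>j. \<Sum>i<d. ip d x (u i) * u i j) y"
    using orthonormal_expansion[OF assms, of _ x] by (intro ip_cong) auto
  then show ?thesis
    by (simp add: ip_linear ip_commute[of d y])
qed

section \<open>The spectral theorem\<close>

text \<open>Entries from index \<open>d\<close> on are fixed to zero, since free entries would
  destroy compactness in the product topology. The set is then a closed subset of a Tychonoff
  cube.\<close>

lemma compact_sphere_section:
  "compact {x :: nat \<Rightarrow> real. (\<forall>i\<ge>d. x i = 0) \<and> ip d x x = 1 \<and> (\<forall>i\<in>I. ip d x (u i) = 0)}"
    (is "compact ?K")
proof -
  define B where "B = PiE UNIV (\<lambda>i. if i < d then {-1..1} else {0 :: real})"
  have "compactin (product_topology (\<lambda>_. euclidean) UNIV) B"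
    unfolding B_def compactin_PiE by auto
  then have cB: "compact B"
    by (simp add: euclidean_product_topology)
  have [continuous_intros]: "continuous_on UNIV (\<lambda>x :: nat \<Rightarrow> real. x i)" for i
    by (rule continuous_on_product_coordinates)
  have "closed ?K"
    unfolding ip_def Ball_def
    by (intro closed_Collect_conj closed_Collect_all closed_Collect_imp open_Collect_const
         closed_Collect_eq continuous_intros)
  moreover have "?K \<subseteq> B"
  proof
    fix x assume x: "x \<in> ?K"
    have "\<bar>x i\<bar> \<le> 1" if "i < d" for i
    proof -
      have "x i * x i \<le> (\<Sum>i<d. x i * x i)"
        using that by (intro member_le_sum) auto
      then have "(x i)\<^sup>2 \<le> 1\<^sup>2"
        using x by (simp add: ip_def power2_eq_square)
      then show ?thesis
        using abs_le_square_iff[of "x i" 1] by simp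
    qed
    then show "x \<in> B"
      using x by (force simp: B_def PiE_def abs_le_iff)
  qed
  ultimately show ?thesis
    using cB compact_Int_closed[of B ?K] by (simp add: inf.absorb2)
qed

text \<open>The first-order condition at a maximum: for small \<open>e\<close> with the sign of
  \<open>b\<close> a nonzero linear term would beat the quadratic one.\<close>

lemma linear_coefficient_zero:
  fixes b c :: real
  assumes "\<And>e. 2 * e * b \<le> e\<^sup>2 * c"
  shows "b = 0"
proof (rule ccontr)
  assume "b \<noteq> 0"
  define K where "K = \<bar>c\<bar> + 1"
  have K: "K > 0" "c < K" by (auto simp: K_def)
  have "2 * (b / K) * b \<le> (b / K)\<^sup>2 * c" by (rule assms)
  also have "\<dots> \<le> (b / K)\<^sup>2 * K" using K by (intro mult_left_mono) auto
  also have "\<dots> = b\<^sup>2 / K" using K by (simp add: power2_eq_square)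
  finally have "2 * b\<^sup>2 / K \<le> b\<^sup>2 / K" by (simp add: power2_eq_square)
  then have "b\<^sup>2 \<le> 0" using K by (simp add: divide_le_cancel)
  with \<open>b \<noteq> 0\<close> show False by simp
qed

text \<open>Maximise the Rayleigh quotient over unit vectors orthogonal to the eigenvectors found so
  far. By symmetry of \<open>S\<close> the residual \<open>r = S x - l x\<close> at a maximiser is
  orthogonal to them as well, hence an admissible direction, and maximality forces
  \<open>r = 0\<close>.\<close>

lemma exists_next_eigenvector:
  assumes S: "symmetric_on d S" and "finite I" and u: "orthonormal_on d I u" and "card I < d"
    and ev: "\<And>k i. k \<in> I \<Longrightarrow> i < d \<Longrightarrow> mv d S (u k) i = lam k * u k i"
  obtains x l where "ip d x x = 1" "\<And>k. k \<in> I \<Longrightarrow> ip d x (u k) = 0"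
    "\<And>i. i < d \<Longrightarrow> mv d S x i = l * x i"
proof -
  define K where "K = {x :: nat \<Rightarrow> real. (\<forall>i\<ge>d. x i = 0) \<and> ip d x x = 1 \<and> (\<forall>i\<in>I. ip d x (u i) = 0)}"
  \<comment> \<open>Scaling to norm one and clearing the entries from \<open>d\<close> on moves
    every nonzero admissible vector into \<open>K\<close>, so the maximum over \<open>K\<close>
    controls all of them.\<close>
  have normalise: "\<exists>x\<in>K. \<exists>c. c > 0 \<and> c\<^sup>2 = ip d y y \<and> (\<forall>i<d. y i = c * x i)"
    if y: "ip d y y \<noteq> 0" "\<And>i. i \<in> I \<Longrightarrow> ip d y (u i) = 0" for y
  proof -
    define c where "c = sqrt (ip d y y)"
    have c: "c > 0" "c\<^sup>2 = ip d y y"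
      using y(1) ip_self_nonneg[of d y] by (auto simp: c_def)
    define x where "x = (\<lambda>i. if i < d then (1 / c) * y i else 0)"
    have ipx: "ip d x z = (1 / c) * ip d y z" for z
      by (subst ip_scale_left[symmetric], rule ip_cong) (auto simp: x_def)
    have "ip d x x = (1 / c) * ((1 / c) * ip d y y)"
      by (simp add: ipx ip_commute[of d y x])
    also have "\<dots> = 1" using c y(1) by (simp add: power2_eq_square field_simps)
    finally have "x \<in> K"
      using y(2) by (auto simp: K_def ipx) (simp add: x_def)
    moreover have "\<forall>i<d. y i = c * x i" using c by (simp add: x_def)
    ultimately show ?thesis using c by blast
  qed
  have "\<exists>j<d. ip d (residual d I u (\<lambda>k. if k = j then 1 else 0))
                  (residual d I u (\<lambda>k. if k = j then 1 else 0)) \<noteq> 0"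
  proof (rule ccontr)
    assume "\<not> ?thesis"
    then have "real d - real (card I) = 0"
      unfolding sum_residual_unit_vectors[OF \<open>finite I\<close> u, symmetric] by (intro sum.neutral) auto
    with \<open>card I < d\<close> show False by simp
  qed
  then have "K \<noteq> {}"
    using normalise residual_orthogonal[OF \<open>finite I\<close> u] by blast
  moreover have "compact K"
    unfolding K_def by (rule compact_sphere_section)
  moreover have "continuous_on K (\<lambda>x. ip d x (mv d S x))"
    unfolding ip_def mv_def
    by (intro continuous_intros continuous_on_subset[OF continuous_on_product_coordinates]) auto
  ultimately obtain x where x: "x \<in> K" and max: "\<And>y. y \<in> K \<Longrightarrow> ip d y (mv d S y) \<le> ip d x (mv d S x)"
    using continuous_attains_sup by metis
  define l where "l = ip d x (mv d S x)"
  have xK: "ip d x x = 1" "\<And>k. k \<in> I \<Longrightarrow> ip d x (u k) = 0"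
    using x by (auto simp: K_def)
  have Rayleigh: "ip d y (mv d S y) \<le> l * ip d y y" if "\<And>i. i \<in> I \<Longrightarrow> ip d y (u i) = 0" for y
  proof (cases "ip d y y = 0")
    case True
    then have "\<forall>i<d. y i = 0" by (simp add: ip_self_eq_0_iff)
    then show ?thesis using True by (simp add: ip_def)
  next
    case False
    with normalise that obtain z c where z: "z \<in> K" "c > 0" "c\<^sup>2 = ip d y y" "\<forall>i<d. y i = c * z i"
      by blast
    have "ip d y (mv d S y) = c\<^sup>2 * ip d z (mv d S z)"
      using z(4) by (simp add: ip_def mv_def sum_distrib_left power2_eq_square algebra_simps)
    also have "\<dots> \<le> c\<^sup>2 * l"
      using max[OF z(1)] by (intro mult_left_mono) (auto simp: l_def)
    finally show ?thesis using z(3) by (simp add: mult.commute)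
  qed
  define r where "r = (\<lambda>i. mv d S x i - l * x i)"
  have r_perp: "ip d r (u k) = 0" if "k \<in> I" for k
  proof -
    have "ip d (mv d S x) (u k) = ip d x (mv d S (u k))"
      by (rule mv_symmetric[OF S])
    also have "\<dots> = ip d x (\<lambda>i. lam k * u k i)"
      using ev[OF that] by (intro ip_cong) auto
    also have "\<dots> = 0" using xK(2)[OF that] by (simp add: ip_linear)
    finally show ?thesis using xK(2)[OF that] by (simp add: r_def ip_linear)
  qed
  \<comment> \<open>Expanding the Rayleigh inequality at \<open>x + e * r\<close>, the coefficient
    of \<open>e\<close> is \<open>2 * ip d r r\<close>.\<close>
  have "ip d r r = 0"
  proof (rule linear_coefficient_zero)
    fix e
    let ?y = "\<lambda>i. x i + e * r i"
    have mvy: "mv d S ?y = (\<lambda>i. mv d S x i + e * mv d S r i)"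
      by (simp add: mv_def algebra_simps sum.distrib sum_distrib_left)
    have "ip d ?y (mv d S ?y) \<le> l * ip d ?y ?y"
      by (rule Rayleigh) (simp add: ip_linear xK r_perp)
    moreover have "ip d ?y (mv d S ?y) = l + 2 * e * ip d r (mv d S x) + e\<^sup>2 * ip d r (mv d S r)"
      using mv_symmetric[OF S, of x r]
      by (simp add: mvy ip_linear l_def ip_commute[of d "mv d S x" r] power2_eq_square algebra_simps)
    moreover have "ip d ?y ?y = 1 + 2 * e * ip d r x + e\<^sup>2 * ip d r r"
      using xK by (simp add: ip_linear ip_commute[of d x r] power2_eq_square algebra_simps)
    moreover have "ip d r (mv d S x) = ip d r r + l * ip d r x"
    proof -
      have "mv d S x = (\<lambda>i. r i + l * x i)" by (simp add: r_def)
      then show ?thesis by (simp add: ip_linear)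
    qed
    ultimately show "2 * e * ip d r r \<le> e\<^sup>2 * (l * ip d r r - ip d r (mv d S r))"
      by (simp add: algebra_simps)
  qed
  then have "mv d S x i = l * x i" if "i < d" for i
    using that by (simp add: ip_self_eq_0_iff r_def)
  with xK that show ?thesis by blast
qed

definition eigenbasis ::
  "nat \<Rightarrow> (nat \<Rightarrow> nat \<Rightarrow> real) \<Rightarrow> (nat \<Rightarrow> nat \<Rightarrow> real) \<Rightarrow> (nat \<Rightarrow> real) \<Rightarrow> bool" where
  "eigenbasis d S u lam \<longleftrightarrow>
     orthonormal_on d {..<d} u \<and> (\<forall>k<d. \<forall>i<d. mv d S (u k) i = lam k * u k i)"

lemma eigenbasisD:
  assumes "eigenbasis d S u lam"
  shows "orthonormal_on d {..<d} u" "k < d \<Longrightarrow> i < d \<Longrightarrow> mv d S (u k) i = lam k * u k i"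
  using assms by (auto simp: eigenbasis_def)

theorem spectral_theorem:
  assumes S: "symmetric_on d S"
  obtains u lam where "eigenbasis d S u lam"
proof -
  have "\<exists>u lam. orthonormal_on d {..<n} u \<and> (\<forall>k<n. \<forall>i<d. mv d S (u k) i = lam k * u k i)"
    if "n \<le> d" for n
    using that
  proof (induction n)
    case 0
    show ?case by (simp add: orthonormal_on_def)
  next
    case (Suc n)
    then obtain u lam where u: "orthonormal_on d {..<n} u"
      and ev: "\<forall>k<n. \<forall>i<d. mv d S (u k) i = lam k * u k i" by auto
    obtain x l where x: "ip d x x = 1" "\<And>k. k \<in> {..<n} \<Longrightarrow> ip d x (u k) = 0"
      "\<And>i. i < d \<Longrightarrow> mv d S x i = l * x i"
      using exists_next_eigenvector[OF S finite_lessThan u, of lam] ev Suc.prems by auto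
    have "orthonormal_on d {..<Suc n} (u(n := x))"
      using u x(1,2) by (auto simp: orthonormal_on_def less_Suc_eq ip_commute[of d "u _" x])
    moreover have "\<forall>k<Suc n. \<forall>i<d. mv d S ((u(n := x)) k) i = (lam(n := l)) k * (u(n := x)) k i"
      using ev x(3) by (auto simp: less_Suc_eq)
    ultimately show ?case by blast
  qed
  from this[of d] that show ?thesis by (auto simp: eigenbasis_def)
qed

section \<open>Matrix powers and traces\<close>

text \<open>Entries lie in any commutative ring, because powers are also taken of matrices of
  polynomials, which get differentiated in one Gaussian coordinate.\<close>

fun mpow :: "nat \<Rightarrow> (nat \<Rightarrow> nat \<Rightarrow> 'a :: comm_ring_1) \<Rightarrow> nat \<Rightarrow> nat \<Rightarrow> nat \<Rightarrow> 'a" where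
  "mpow d X 0 i j = (if i = j then 1 else 0)"
| "mpow d X (Suc n) i j = (\<Sum>k<d. X i k * mpow d X n k j)"

definition tr :: "nat \<Rightarrow> (nat \<Rightarrow> nat \<Rightarrow> real) \<Rightarrow> real" where
  "tr d X = (\<Sum>i<d. X i i)"

lemma poly_mpow: "poly (mpow d P n i j) t = mpow d (\<lambda>i j. poly (P i j) t) n i j"
  by (induction n arbitrary: i j) (auto simp: poly_sum)

text \<open>The Leibniz rule for factors that need not commute: \<open>q\<close> counts the factors
  to the left of the differentiated one.\<close>

lemma pderiv_mpow:
  fixes P :: "nat \<Rightarrow> nat \<Rightarrow> real poly"
  assumes "i < d"
  shows "pderiv (mpow d P n i j) =
    (\<Sum>q<n. \<Sum>a<d. \<Sum>b<d. mpow d P q i a * pderiv (P a b) * mpow d P (n - 1 - q) b j)"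
  using assms
proof (induction n arbitrary: i)
  case 0
  then show ?case by simp
next
  case (Suc n)
  let ?G = "\<lambda>q i. \<Sum>a<d. \<Sum>b<d. mpow d P q i a * pderiv (P a b) * mpow d P (n - 1 - q) b j"
  have "pderiv (mpow d P (Suc n) i j) =
      (\<Sum>k<d. P i k * pderiv (mpow d P n k j)) + (\<Sum>k<d. pderiv (P i k) * mpow d P n k j)"
    by (simp add: pderiv_sum pderiv_mult sum.distrib mult.commute)
  also have "(\<Sum>k<d. P i k * pderiv (mpow d P n k j)) = (\<Sum>k<d. P i k * (\<Sum>q<n. ?G q k))"
    using Suc.IH by (intro sum.cong) auto
  also have "\<dots> = (\<Sum>q<n. \<Sum>k<d. P i k * ?G q k)"
    by (simp only: sum_distrib_left) (rule sum.swap)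
  also have "\<dots> = (\<Sum>q<n. \<Sum>a<d. \<Sum>b<d. mpow d P (Suc q) i a * pderiv (P a b) * mpow d P (Suc n - 1 - Suc q) b j)"
  proof (rule sum.cong[OF refl])
    fix q
    have "(\<Sum>k<d. P i k * ?G q k) =
        (\<Sum>k<d. \<Sum>a<d. \<Sum>b<d. P i k * mpow d P q k a * pderiv (P a b) * mpow d P (n - 1 - q) b j)"
      by (simp add: sum_distrib_left mult.assoc)
    also have "\<dots> = (\<Sum>a<d. \<Sum>b<d. \<Sum>k<d. P i k * mpow d P q k a * pderiv (P a b) * mpow d P (n - 1 - q) b j)"
      by (subst sum.swap) (rule sum.cong[OF refl], rule sum.swap)
    finally show "(\<Sum>k<d. P i k * ?G q k) =
        (\<Sum>a<d. \<Sum>b<d. mpow d P (Suc q) i a * pderiv (P a b) * mpow d P (Suc n - 1 - Suc q) b j)"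
      by (simp add: sum_distrib_right)
  qed
  also have "(\<Sum>k<d. pderiv (P i k) * mpow d P n k j) =
      (\<Sum>a<d. \<Sum>b<d. mpow d P 0 i a * pderiv (P a b) * mpow d P (Suc n - 1 - 0) b j)"
  proof -
    have "(\<Sum>a<d. \<Sum>b<d. mpow d P 0 i a * pderiv (P a b) * mpow d P (Suc n - 1 - 0) b j) =
        (\<Sum>a<d. if i = a then \<Sum>b<d. pderiv (P i b) * mpow d P n b j else 0)"
      by (intro sum.cong refl) auto
    then show ?thesis using Suc.prems by simp
  qed
  finally show ?case
    by (subst sum.lessThan_Suc_shift) (simp add: add.commute)
qed

lemma mpow_spectral:
  assumes eb: "eigenbasis d X u lam"
    and "i < d" "j < d"
  shows "mpow d X n i j = (\<Sum>k<d. lam k ^ n * u k i * u k j)"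
  using assms(2)
proof (induction n arbitrary: i)
  case 0
  have "ip d (\<lambda>k. if k = i then 1 else 0) x = x i" for x
    using 0 by (simp add: ip_def if_distrib[of "\<lambda>z. z * _"] cong: if_cong)
  with orthonormal_expansion[OF eigenbasisD(1)[OF eb] assms(3), of "\<lambda>k. if k = i then 1 else 0"]
  show ?case by (auto simp: eq_commute)
next
  case (Suc n)
  have "mpow d X (Suc n) i j = (\<Sum>l<d. \<Sum>k<d. lam k ^ n * u k j * (X i l * u k l))"
    using Suc.IH by (simp add: sum_distrib_left algebra_simps)
  also have "\<dots> = (\<Sum>k<d. lam k ^ n * u k j * mv d X (u k) i)"
    by (subst sum.swap) (simp add: mv_def sum_distrib_left)
  also have "\<dots> = (\<Sum>k<d. lam k ^ Suc n * u k i * u k j)"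
    using eigenbasisD(2)[OF eb] Suc.prems by (simp add: algebra_simps)
  finally show ?case .
qed

lemma tr_mpow_spectral:
  assumes eb: "eigenbasis d X u lam"
  shows "tr d (mpow d X n) = (\<Sum>k<d. lam k ^ n)"
proof -
  have "tr d (mpow d X n) = (\<Sum>i<d. \<Sum>k<d. lam k ^ n * (u k i * u k i))"
    using mpow_spectral[OF eb] by (simp add: tr_def mult.assoc)
  also have "\<dots> = (\<Sum>k<d. lam k ^ n * ip d (u k) (u k))"
    by (subst sum.swap) (simp add: ip_def sum_distrib_left)
  also have "\<dots> = (\<Sum>k<d. lam k ^ n)"
    using eigenbasisD(1)[OF eb] by (simp add: orthonormal_onD)
  finally show ?thesis .
qed

lemma tr_mpow_even_nonneg:
  assumes "symmetric_on d X"
  shows "0 \<le> tr d (mpow d X (2 * m))"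
proof -
  obtain u lam where "eigenbasis d X u lam"
    using spectral_theorem[OF assms] by metis
  then show ?thesis
    by (simp add: tr_mpow_spectral sum_nonneg power_mult)
qed

lemma quadratic_form_spectral:
  assumes eb: "eigenbasis d X u lam"
    and S: "symmetric_on d X"
  shows "ip d (mv d X x) y = (\<Sum>k<d. lam k * ip d x (u k) * ip d y (u k))"
proof -
  have "ip d (mv d X x) (u k) = lam k * ip d x (u k)" if "k < d" for k
  proof -
    have "ip d (mv d X x) (u k) = ip d x (\<lambda>i. lam k * u k i)"
      unfolding mv_symmetric[OF S] using eigenbasisD(2)[OF eb that] by (intro ip_cong) auto
    then show ?thesis by (simp add: ip_linear)
  qed
  then show ?thesis
    by (subst Parseval[OF eigenbasisD(1)[OF eb], of "mv d X x"]) simp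
qed

text \<open>The trace of an even power dominates each \<open>lam k ^ (2 * m)\<close>, which bounds
  every eigenvalue by \<open>s\<close> in absolute value; Parseval and Cauchy-Schwarz do the
  rest.\<close>

lemma bilinear_form_le_of_trace:
  assumes S: "symmetric_on d X" and "m > 0" and "0 \<le> s"
    and le: "tr d (mpow d X (2 * m)) \<le> s ^ (2 * m)"
  shows "\<bar>ip d (mv d X x) y\<bar> \<le> s * sqrt (ip d x x) * sqrt (ip d y y)"
proof -
  obtain u lam where eb: "eigenbasis d X u lam"
    using spectral_theorem[OF S] by metis
  note u = eigenbasisD(1)[OF eb]
  have lam: "\<bar>lam k\<bar> \<le> s" if "k < d" for k
  proof -
    have "lam k ^ (2 * m) \<le> (\<Sum>k<d. lam k ^ (2 * m))"
      using that by (intro member_le_sum) (auto simp: power_mult)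
    also have "\<dots> \<le> s ^ (2 * m)"
      using le tr_mpow_spectral[OF eb, of "2 * m"] by simp
    finally have "\<bar>lam k\<bar> ^ (2 * m) \<le> s ^ (2 * m)"
      by (simp add: power_even_abs)
    then show ?thesis
      using \<open>m > 0\<close> \<open>0 \<le> s\<close> by (subst (asm) power_mono_iff) auto
  qed
  have "\<bar>ip d (mv d X x) y\<bar> \<le> (\<Sum>k<d. \<bar>lam k * ip d x (u k) * ip d y (u k)\<bar>)"
    unfolding quadratic_form_spectral[OF eb S] by (rule sum_abs)
  also have "\<dots> \<le> (\<Sum>k<d. s * (\<bar>ip d x (u k)\<bar> * \<bar>ip d y (u k)\<bar>))"
    using lam by (intro sum_mono) (simp add: abs_mult mult.assoc mult_right_mono)
  also have "\<dots> = s * (\<Sum>k<d. \<bar>ip d x (u k)\<bar> * \<bar>ip d y (u k)\<bar>)"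
    by (simp add: sum_distrib_left)
  also have "(\<Sum>k<d. \<bar>ip d x (u k)\<bar> * \<bar>ip d y (u k)\<bar>) \<le> sqrt (ip d x x) * sqrt (ip d y y)"
  proof -
    have "(\<Sum>k<d. \<bar>ip d x (u k)\<bar> * \<bar>ip d y (u k)\<bar>)\<^sup>2 \<le>
        (\<Sum>k<d. \<bar>ip d x (u k)\<bar>\<^sup>2) * (\<Sum>k<d. \<bar>ip d y (u k)\<bar>\<^sup>2)"
      by (rule Cauchy_Schwarz_ineq_sum)
    also have "\<dots> = ip d x x * ip d y y"
      by (simp add: Parseval[OF u, of x x] Parseval[OF u, of y y] power2_eq_square)
    finally show ?thesis
      by (simp add: real_le_rsqrt real_sqrt_mult[symmetric])
  qed
  finally show ?thesis
    using \<open>0 \<le> s\<close> by (simp add: mult_left_mono mult.assoc)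
qed

text \<open>For both exponents the power of \<open>\<bar>x\<bar>\<close> is monotone, so the two
  differences have the same sign. Absolute values disappear on the right because
  \<open>q + r\<close> is even.\<close>

lemma power_rearrangement:
  fixes x y :: real
  assumes "q + r = 2 * N"
  shows "x ^ q * y ^ r + x ^ r * y ^ q \<le> x ^ (2 * N) + y ^ (2 * N)"
proof -
  have nonneg: "0 \<le> (\<bar>x\<bar> ^ q - \<bar>y\<bar> ^ q) * (\<bar>x\<bar> ^ r - \<bar>y\<bar> ^ r)"
  proof (cases "\<bar>x\<bar> \<le> \<bar>y\<bar>")
    case True
    then show ?thesis by (intro mult_nonpos_nonpos) (auto simp: power_mono)
  next
    case False
    then show ?thesis by (intro mult_nonneg_nonneg) (auto simp: power_mono)
  qed
  have "x ^ q * y ^ r + x ^ r * y ^ q \<le> \<bar>x ^ q * y ^ r\<bar> + \<bar>x ^ r * y ^ q\<bar>"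
    by linarith
  also have "\<dots> = \<bar>x\<bar> ^ q * \<bar>y\<bar> ^ r + \<bar>x\<bar> ^ r * \<bar>y\<bar> ^ q"
    by (simp add: abs_mult power_abs)
  also have "\<dots> \<le> \<bar>x\<bar> ^ (q + r) + \<bar>y\<bar> ^ (q + r)"
    using nonneg by (simp add: power_add algebra_simps)
  also have "\<dots> = x ^ (2 * N) + y ^ (2 * N)"
    by (simp add: assms power_even_abs)
  finally show ?thesis .
qed

text \<open>In an eigenbasis of \<open>X\<close> the trace is \<open>\<Sum>\<^sub>k\<^sub>l \<lambda>\<^sub>k\<^sup>q \<lambda>\<^sub>l\<^sup>r h\<^sub>k\<^sub>l\<^sup>2\<close>; symmetrising in \<open>k, l\<close> reduces the
  bound to the scalar rearrangement inequality.\<close>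

lemma trace_interlaced_powers_le:
  assumes eb: "eigenbasis d X u lam"
    and H: "symmetric_on d H" and qr: "q + r = 2 * N"
  shows "(\<Sum>i<d. \<Sum>a<d. (\<Sum>j<d. H i j * mpow d X q j a) * (\<Sum>b<d. H a b * mpow d X r b i))
    \<le> (\<Sum>k<d. lam k ^ (2 * N) * ip d (mv d H (u k)) (mv d H (u k)))"
proof -
  note u = eigenbasisD(1)[OF eb]
  define h where "h k l = ip d (mv d H (u k)) (u l)" for k l
  have h_sym: "h k l = h l k" for k l
    unfolding h_def by (subst mv_symmetric[OF H]) (rule ip_commute)
  have hh: "h k l * h l k = (h k l)\<^sup>2" for k l
    using h_sym[of k l] by (simp add: power2_eq_square)
  have half: "(\<Sum>j<d. H i j * mpow d X n j a) = (\<Sum>k<d. lam k ^ n * mv d H (u k) i * u k a)"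
    if "a < d" for i a n
  proof -
    have "(\<Sum>j<d. H i j * mpow d X n j a) = (\<Sum>j<d. \<Sum>k<d. lam k ^ n * (H i j * u k j) * u k a)"
      using mpow_spectral[OF eb _ that] by (simp add: sum_distrib_left algebra_simps)
    also have "\<dots> = (\<Sum>k<d. lam k ^ n * mv d H (u k) i * u k a)"
      by (subst sum.swap) (simp add: mv_def sum_distrib_left sum_distrib_right)
    finally show ?thesis .
  qed
  have "(\<Sum>i<d. \<Sum>a<d. (\<Sum>j<d. H i j * mpow d X q j a) * (\<Sum>b<d. H a b * mpow d X r b i)) =
      (\<Sum>i<d. \<Sum>a<d. \<Sum>k<d. \<Sum>l<d. lam k ^ q * lam l ^ r * ((mv d H (u k) i * u l i) * (mv d H (u l) a * u k a)))"
  proof (rule sum.cong[OF refl], rule sum.cong[OF refl])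
    fix i a assume "i \<in> {..<d}" "a \<in> {..<d}"
    then have "i < d" "a < d" by auto
    show "(\<Sum>j<d. H i j * mpow d X q j a) * (\<Sum>b<d. H a b * mpow d X r b i) =
      (\<Sum>k<d. \<Sum>l<d. lam k ^ q * lam l ^ r * ((mv d H (u k) i * u l i) * (mv d H (u l) a * u k a)))"
      unfolding half[OF \<open>i < d\<close>] half[OF \<open>a < d\<close>] sum_product
      by (intro sum.cong refl) (simp only: mult_ac)
  qed
  also have "\<dots> = (\<Sum>i<d. \<Sum>k<d. \<Sum>a<d. \<Sum>l<d. lam k ^ q * lam l ^ r * ((mv d H (u k) i * u l i) * (mv d H (u l) a * u k a)))"
    by (rule sum.cong[OF refl], rule sum.swap)
  also have "\<dots> = (\<Sum>k<d. \<Sum>i<d. \<Sum>l<d. \<Sum>a<d. lam k ^ q * lam l ^ r * ((mv d H (u k) i * u l i) * (mv d H (u l) a * u k a)))"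
    by (subst sum.swap) (rule sum.cong[OF refl], rule sum.cong[OF refl], rule sum.swap)
  also have "\<dots> = (\<Sum>k<d. \<Sum>l<d. \<Sum>i<d. \<Sum>a<d. lam k ^ q * lam l ^ r * ((mv d H (u k) i * u l i) * (mv d H (u l) a * u k a)))"
    by (rule sum.cong[OF refl], rule sum.swap)
  also have "\<dots> = (\<Sum>k<d. \<Sum>l<d. lam k ^ q * lam l ^ r * (h k l * h l k))"
    by (simp only: h_def ip_def sum_product) (simp only: sum_distrib_left)
  also have "\<dots> = (\<Sum>k<d. \<Sum>l<d. lam k ^ q * lam l ^ r * (h k l)\<^sup>2)" (is "_ = ?Q")
    by (simp only: hh)
  finally have eq: "(\<Sum>i<d. \<Sum>a<d. (\<Sum>j<d. H i j * mpow d X q j a) * (\<Sum>b<d. H a b * mpow d X r b i)) = ?Q" .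
  have swapped: "(\<Sum>k<d. \<Sum>l<d. f l k * (h k l)\<^sup>2) = (\<Sum>k<d. \<Sum>l<d. f k l * (h k l)\<^sup>2)" for f
    by (subst sum.swap) (intro sum.cong refl arg_cong2[of _ _ _ _ "(*)"] arg_cong[of _ _ "\<lambda>x. x\<^sup>2"] h_sym)
  have "2 * ?Q = ?Q + (\<Sum>k<d. \<Sum>l<d. lam l ^ q * lam k ^ r * (h k l)\<^sup>2)"
    using swapped[of "\<lambda>k l. lam k ^ q * lam l ^ r"] by simp
  also have "\<dots> = (\<Sum>k<d. \<Sum>l<d. (lam k ^ q * lam l ^ r + lam k ^ r * lam l ^ q) * (h k l)\<^sup>2)"
    by (simp add: sum.distrib algebra_simps)
  also have "\<dots> \<le> (\<Sum>k<d. \<Sum>l<d. (lam k ^ (2 * N) + lam l ^ (2 * N)) * (h k l)\<^sup>2)"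
    by (intro sum_mono mult_right_mono power_rearrangement qr) auto
  also have "\<dots> = 2 * (\<Sum>k<d. \<Sum>l<d. lam k ^ (2 * N) * (h k l)\<^sup>2)"
    using swapped[of "\<lambda>k l. lam k ^ (2 * N)"] by (simp add: sum.distrib algebra_simps)
  also have "(\<Sum>k<d. \<Sum>l<d. lam k ^ (2 * N) * (h k l)\<^sup>2) =
      (\<Sum>k<d. lam k ^ (2 * N) * ip d (mv d H (u k)) (mv d H (u k)))"
    unfolding h_def by (subst Parseval[OF u, of "mv d H _"]) (simp add: sum_distrib_left power2_eq_square)
  finally show ?thesis
    using eq by simp
qed

section \<open>Gaussian integration by parts\<close>

abbreviation gauss :: "real measure" where
  "gauss \<equiv> density lborel std_normal_density"

lemma prob_space_gauss: "prob_space gauss"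
  using prob_space_normal_density[of 1 0] by simp

lemma product_sigma_finite_gauss: "product_sigma_finite (\<lambda>_. gauss)"
  by (simp add: product_sigma_finite_def prob_space_imp_sigma_finite prob_space_gauss)

lemma integral_gauss:
  fixes f :: "real \<Rightarrow> real"
  assumes "f \<in> borel_measurable borel"
  shows "(LINT y|gauss. f y) = (LINT y|lborel. std_normal_density y * f y)"
  using assms by (subst integral_density) (auto simp: normal_density_nonneg)

lemma integrable_gauss_power: "integrable gauss (\<lambda>y. y ^ n)"
  using integrable_std_normal_moment[of n]
  by (subst integrable_density) (auto simp: normal_density_nonneg)

lemma integrable_gauss_abs_power: "integrable gauss (\<lambda>y. \<bar>y\<bar> ^ n)"
  using integrable_std_normal_moment_abs[of n]
  by (subst integrable_density) (auto simp: normal_density_nonneg)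

text \<open>Integration by parts for a monomial, read off from the explicit even and odd moments. At
  \<open>n = 0\<close> the truncated exponent \<open>n - 1\<close> is multiplied by zero.\<close>

lemma gauss_moment_Suc:
  "(LINT y|gauss. y ^ Suc n) = real n * (LINT y|gauss. y ^ (n - 1))"
proof -
  have even: "(LINT y|gauss. y ^ (2 * k)) = fact (2 * k) / (2 ^ k * fact k)" for k
    by (subst integral_gauss) (auto simp: integral_std_normal_moment_even)
  have odd: "(LINT y|gauss. y ^ (2 * k + 1)) = 0" for k
    using integral_std_normal_moment_odd[of k] by (subst integral_gauss) auto
  show ?thesis
  proof (cases "even n")
    case True
    then obtain k where k: "n = 2 * k" by (elim evenE)
    show ?thesis
    proof (cases k)
      case 0
      then show ?thesis using odd[of 0] k by simp
    next
      case (Suc l)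
      then have "n - 1 = 2 * l + 1" "Suc n = 2 * k + 1" using k by auto
      then show ?thesis using odd by (metis mult_zero_right)
    qed
  next
    case False
    then obtain k where k: "n = 2 * k + 1" by (elim oddE)
    have "(LINT y|gauss. y ^ Suc n) = fact (2 * Suc k) / (2 ^ Suc k * fact (Suc k))"
      using even[of "Suc k"] k by simp
    also have "\<dots> = real n * (fact (2 * k) / (2 ^ k * fact k))"
    proof -
      have "fact (2 * Suc k) = (2 * (real k + 1)) * (real n * fact (2 * k))"
        "2 ^ Suc k * fact (Suc k) = (2 * (real k + 1)) * (2 ^ k * fact k)"
        using k by (simp_all add: algebra_simps)
      then show ?thesis
        by (simp only: times_divide_eq_right, subst mult_divide_mult_cancel_left) auto
    qed
    finally show ?thesis using even[of k] k by simp
  qed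
qed

lemma gauss_integration_by_parts:
  "(LINT y|gauss. y * poly p y) = (LINT y|gauss. poly (pderiv p) y)"
proof -
  have p: "poly p y = (\<Sum>i\<le>degree p. coeff p i * y ^ i)" for y
    by (rule poly_altdef)
  have dp: "poly (pderiv p) y = (\<Sum>i\<le>degree p. coeff p i * (real i * y ^ (i - 1)))" for y
    by (subst poly_as_sum_of_monoms[of p, symmetric])
       (simp add: pderiv_sum pderiv_monom poly_sum poly_monom mult_ac)
  have "(LINT y|gauss. y * poly p y) = (LINT y|gauss. (\<Sum>i\<le>degree p. coeff p i * y ^ Suc i))"
    by (simp add: p sum_distrib_left mult_ac)
  also have "\<dots> = (\<Sum>i\<le>degree p. coeff p i * (LINT y|gauss. y ^ Suc i))"
    by (subst Bochner_Integration.integral_sum)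
       (auto simp del: power_Suc intro!: integrable_mult_right integrable_gauss_power)
  also have "\<dots> = (\<Sum>i\<le>degree p. coeff p i * (real i * (LINT y|gauss. y ^ (i - 1))))"
    by (simp only: gauss_moment_Suc)
  also have "\<dots> = (LINT y|gauss. (\<Sum>i\<le>degree p. coeff p i * (real i * y ^ (i - 1))))"
    by (subst Bochner_Integration.integral_sum)
       (auto intro!: integrable_mult_right integrable_gauss_power)
  finally show ?thesis by (simp add: dp)
qed

text \<open>Unlike integrability, this property passes to products, so it gives the integrability of
  every polynomial in the Gaussian coordinates.\<close>

definition all_moments :: "'a measure \<Rightarrow> ('a \<Rightarrow> real) \<Rightarrow> bool" where
  "all_moments M f \<longleftrightarrow> f \<in> borel_measurable M \<and> (\<forall>p. integrable M (\<lambda>x. \<bar>f x\<bar> ^ p))"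

lemma all_moments_integrable: "all_moments M f \<Longrightarrow> integrable M f"
  unfolding all_moments_def by (metis (no_types, lifting) integrable_abs_cancel power_one_right ext)

lemma all_moments_const: "finite_measure M \<Longrightarrow> all_moments M (\<lambda>_. c)"
  by (auto simp: all_moments_def finite_measure.integrable_const)

lemma all_moments_mult:
  assumes "all_moments M f" "all_moments M g"
  shows "all_moments M (\<lambda>x. f x * g x)"
proof -
  have "integrable M (\<lambda>x. \<bar>f x * g x\<bar> ^ p)" for p
  proof (rule Bochner_Integration.integrable_bound)
    show "integrable M (\<lambda>x. \<bar>f x\<bar> ^ (2 * p) + \<bar>g x\<bar> ^ (2 * p))"
      using assms unfolding all_moments_def by (intro Bochner_Integration.integrable_add) auto
    have "\<bar>f x * g x\<bar> ^ p \<le> \<bar>f x\<bar> ^ (2 * p) + \<bar>g x\<bar> ^ (2 * p)" for x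
    proof -
      let ?a = "\<bar>f x\<bar> ^ p" and ?b = "\<bar>g x\<bar> ^ p"
      have "0 \<le> ?a * ?b" by simp
      with sum_squares_bound[of ?a ?b] have "?a * ?b \<le> ?a\<^sup>2 + ?b\<^sup>2"
        by (simp only: mult.assoc)
      then show ?thesis
        by (simp add: abs_mult power_mult_distrib power_mult mult.commute[of 2 p])
    qed
    then show "AE x in M. norm (\<bar>f x * g x\<bar> ^ p) \<le> norm (\<bar>f x\<bar> ^ (2 * p) + \<bar>g x\<bar> ^ (2 * p))"
      by (auto intro!: AE_I2 order_trans[OF _ abs_ge_self])
  qed (use assms in \<open>auto simp: all_moments_def\<close>)
  then show ?thesis
    using assms by (auto simp: all_moments_def)
qed

lemma all_moments_add:
  assumes "all_moments M f" "all_moments M g"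
  shows "all_moments M (\<lambda>x. f x + g x)"
proof -
  have "integrable M (\<lambda>x. \<bar>f x + g x\<bar> ^ p)" for p
  proof (rule Bochner_Integration.integrable_bound)
    show "integrable M (\<lambda>x. 2 ^ p * (\<bar>f x\<bar> ^ p + \<bar>g x\<bar> ^ p))"
      using assms unfolding all_moments_def
      by (intro integrable_mult_right Bochner_Integration.integrable_add) auto
    have "\<bar>f x + g x\<bar> ^ p \<le> 2 ^ p * (\<bar>f x\<bar> ^ p + \<bar>g x\<bar> ^ p)" for x
    proof -
      have "\<bar>f x + g x\<bar> ^ p \<le> (2 * max \<bar>f x\<bar> \<bar>g x\<bar>) ^ p"
        by (intro power_mono) auto
      also have "\<dots> = 2 ^ p * max \<bar>f x\<bar> \<bar>g x\<bar> ^ p"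
        by (simp add: power_mult_distrib)
      also have "\<dots> \<le> 2 ^ p * (\<bar>f x\<bar> ^ p + \<bar>g x\<bar> ^ p)"
        by (intro mult_left_mono) (auto simp: max_def)
      finally show ?thesis .
    qed
    then show "AE x in M. norm (\<bar>f x + g x\<bar> ^ p) \<le> norm (2 ^ p * (\<bar>f x\<bar> ^ p + \<bar>g x\<bar> ^ p))"
      by (auto intro!: AE_I2 order_trans[OF _ abs_ge_self])
  qed (use assms in \<open>auto simp: all_moments_def\<close>)
  then show ?thesis
    using assms by (auto simp: all_moments_def)
qed

lemma all_moments_sum:
  assumes "finite_measure M" "\<And>i. i \<in> I \<Longrightarrow> all_moments M (f i)"
  shows "all_moments M (\<lambda>x. \<Sum>i\<in>I. f i x)"
  using assms(2)
  by (induction I rule: infinite_finite_induct)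
     (auto intro: all_moments_add all_moments_const[OF assms(1)])

section \<open>Coordinates of the standard Gaussian vector\<close>

lemma prob_space_std_gaussian: "prob_space (std_gaussian d)"
  unfolding std_gaussian_def by (intro prob_space_PiM prob_space_gauss)

lemma finite_measure_std_gaussian: "finite_measure (std_gaussian d)"
  using prob_space_std_gaussian[of d] by (rule prob_space.finite_measure)

lemma measurable_std_gaussian_component:
  "k < d \<Longrightarrow> (\<lambda>g. g k) \<in> borel_measurable (std_gaussian d)"
  unfolding std_gaussian_def
  by (rule measurable_compose[OF measurable_component_singleton]) auto

lemma distr_std_gaussian_component:
  assumes "k < d"
  shows "distr (std_gaussian d) gauss (\<lambda>g. g k) = gauss"
  unfolding std_gaussian_def using assms
  by (intro distr_PiM_component prob_space_gauss) auto

lemma all_moments_component: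
  assumes "k < d"
  shows "all_moments (std_gaussian d) (\<lambda>g. g k)"
proof -
  have m: "(\<lambda>g. g k) \<in> measurable (std_gaussian d) gauss"
    using measurable_std_gaussian_component[OF assms] by (simp cong: measurable_cong_sets)
  have "integrable (std_gaussian d) (\<lambda>g. \<bar>g k\<bar> ^ p)" for p
    using integrable_distr[OF m, of "\<lambda>y. \<bar>y\<bar> ^ p"]
    by (simp add: distr_std_gaussian_component[OF assms] integrable_gauss_abs_power)
  then show ?thesis
    using measurable_std_gaussian_component[OF assms] by (simp add: all_moments_def)
qed

text \<open>\<open>P g\<close> is a polynomial in the coordinate \<open>g k\<close> with
  coefficients depending on the other coordinates only, so Fubini reduces the claim to one
  dimension.\<close>

lemma std_gaussian_integration_by_parts:
  fixes P :: "(nat \<Rightarrow> real) \<Rightarrow> real poly"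
  assumes "k < d" and P: "\<And>g y. P (g(k := y)) = P g"
    and int: "integrable (std_gaussian d) (\<lambda>g. g k * poly (P g) (g k))"
      "integrable (std_gaussian d) (\<lambda>g. poly (pderiv (P g)) (g k))"
  shows "(LINT g|std_gaussian d. g k * poly (P g) (g k)) = (LINT g|std_gaussian d. poly (pderiv (P g)) (g k))"
proof -
  interpret product_sigma_finite "\<lambda>_ :: nat. gauss"
    by (rule product_sigma_finite_gauss)
  let ?I = "{..<d} - {k}"
  have I: "{..<d} = insert k ?I" using \<open>k < d\<close> by auto
  have M: "std_gaussian d = PiM (insert k ?I) (\<lambda>_. gauss)"
    by (simp only: std_gaussian_def I[symmetric])
  have "(LINT g|std_gaussian d. g k * poly (P g) (g k)) =
      (LINT x|PiM ?I (\<lambda>_. gauss). (LINT y|gauss. y * poly (P x) y))"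
    using int(1) unfolding M by (subst product_integral_insert) (auto simp: P)
  also have "\<dots> = (LINT x|PiM ?I (\<lambda>_. gauss). (LINT y|gauss. poly (pderiv (P x)) y))"
    by (simp only: gauss_integration_by_parts)
  also have "\<dots> = (LINT g|std_gaussian d. poly (pderiv (P g)) (g k))"
    using int(2) unfolding M by (subst product_integral_insert) (auto simp: P)
  finally show ?thesis .
qed

section \<open>Moments of a Gaussian matrix series\<close>

definition contr :: "nat \<Rightarrow> tensor3 \<Rightarrow> (nat \<Rightarrow> real) \<Rightarrow> nat \<Rightarrow> nat \<Rightarrow> real" where
  "contr d E g i j = (\<Sum>k<d. E i j k * g k)"

lemma all_moments_mpow_contr: "all_moments (std_gaussian d) (\<lambda>g. mpow d (contr d E g) n i j)"
proof (induction n arbitrary: i)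
  case 0
  show ?case by (simp add: all_moments_const finite_measure_std_gaussian)
next
  case (Suc n)
  show ?case
    unfolding mpow.simps contr_def[of d E _ i]
    by (intro all_moments_sum all_moments_mult all_moments_const all_moments_component
          finite_measure_std_gaussian Suc.IH) auto
qed

lemma integral_component_mpow_contr:
  assumes "k < d" "i < d"
  shows "(LINT g|std_gaussian d. g k * mpow d (contr d E g) n i j) =
    (LINT g|std_gaussian d. (\<Sum>q<n. \<Sum>a<d. \<Sum>b<d.
       mpow d (contr d E g) q i a * E a b k * mpow d (contr d E g) (n - 1 - q) b j))"
proof -
  \<comment> \<open>Each entry of the contraction is affine in \<open>g k\<close>: the other
    coordinates form the constant term, and \<open>E a b k\<close> is the slope.\<close>
  define Y where "Y g a b = [:(\<Sum>l\<in>{..<d} - {k}. E a b l * g l), E a b k:]" for g :: "nat \<Rightarrow> real" and a b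
  define P where "P g = mpow d (Y g) n i j" for g
  have Y: "poly (Y g a b) (g k) = contr d E g a b" for g a b
    using assms(1) by (simp add: Y_def contr_def sum.remove[of "{..<d}" k] mult.commute)
  have P: "poly (P g) (g k) = mpow d (contr d E g) n i j" for g
    by (simp add: P_def poly_mpow Y)
  have dP: "poly (pderiv (P g)) (g k) = (\<Sum>q<n. \<Sum>a<d. \<Sum>b<d.
       mpow d (contr d E g) q i a * E a b k * mpow d (contr d E g) (n - 1 - q) b j)" for g
    unfolding P_def pderiv_mpow[OF assms(2)] poly_sum poly_mult poly_mpow Y
    by (simp add: Y_def pderiv_pCons)
  have "Y (g(k := y)) = Y g" for g y
    unfolding Y_def by (intro ext) (auto intro!: sum.cong)
  then have "P (g(k := y)) = P g" for g y
    by (simp add: P_def)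
  moreover have "integrable (std_gaussian d) (\<lambda>g. g k * poly (P g) (g k))"
    unfolding P
    by (intro all_moments_integrable all_moments_mult all_moments_component all_moments_mpow_contr assms)
  moreover have "integrable (std_gaussian d) (\<lambda>g. poly (pderiv (P g)) (g k))"
    unfolding dP
    by (intro all_moments_integrable all_moments_sum all_moments_mult all_moments_const
          finite_measure_std_gaussian all_moments_mpow_contr)
  ultimately show ?thesis
    using std_gaussian_integration_by_parts[OF assms(1), of P] unfolding P dP by blast
qed

lemma symmetric_contr:
  "(\<And>k. k < d \<Longrightarrow> symmetric_on d (\<lambda>i j. E i j k)) \<Longrightarrow> symmetric_on d (contr d E g)"
  by (auto simp: symmetric_on_def contr_def intro!: sum.cong)

lemma integrable_tr_mpow_contr: "integrable (std_gaussian d) (\<lambda>g. tr d (mpow d (contr d E g) n))"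
  unfolding tr_def
  by (intro all_moments_integrable all_moments_sum all_moments_mpow_contr finite_measure_std_gaussian)

text \<open>Let \<open>X\<close> be the contraction and \<open>H\<close> the \<open>k\<close>-th
  slice. Splitting one factor off the power and integrating by parts in \<open>g k\<close> gives
  \<open>2 * N + 1\<close> terms \<open>tr (H X^q H X^r)\<close> with \<open>q + r = 2 * N\<close>.
  Each is at most \<open>tr (H^2 X^(2 N))\<close>, and summing over the slices costs the factor
  \<open>\<tau>^2\<close>.\<close>

lemma trace_moment_Suc:
  fixes E :: tensor3
  assumes sym: "\<And>k. k < d \<Longrightarrow> symmetric_on d (\<lambda>i j. E i j k)"
    and bound: "\<And>x. (\<Sum>k<d. ip d (mv d (\<lambda>i j. E i j k) x) (mv d (\<lambda>i j. E i j k) x)) \<le> \<tau>\<^sup>2 * ip d x x"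
  shows "(LINT g|std_gaussian d. tr d (mpow d (contr d E g) (2 * Suc N))) \<le>
    real (2 * N + 1) * \<tau>\<^sup>2 * (LINT g|std_gaussian d. tr d (mpow d (contr d E g) (2 * N)))"
proof -
  let ?M = "std_gaussian d" and ?X = "\<lambda>g. contr d E g" and ?n = "2 * N + 1"
  let ?S = "\<lambda>g q k. \<Sum>i<d. \<Sum>a<d. (\<Sum>j<d. E i j k * mpow d (?X g) q j a) *
              (\<Sum>b<d. E a b k * mpow d (?X g) (2 * N - q) b i)"
  note int = all_moments_integrable all_moments_sum all_moments_mult all_moments_const
          finite_measure_std_gaussian all_moments_mpow_contr all_moments_component
  have expand: "tr d (mpow d (?X g) (2 * Suc N)) =
      (\<Sum>i<d. \<Sum>j<d. \<Sum>k<d. E i j k * (g k * mpow d (?X g) ?n j i))" for g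
    by (simp add: tr_def contr_def sum_distrib_right mult.assoc del: mpow.simps(2))
       (simp add: contr_def[of d E g] sum_distrib_right mult.assoc)
  have "(LINT g|?M. tr d (mpow d (?X g) (2 * Suc N))) =
      (\<Sum>i<d. \<Sum>j<d. \<Sum>k<d. E i j k * (LINT g|?M. g k * mpow d (?X g) ?n j i))"
    unfolding expand
    by (subst Bochner_Integration.integral_sum, (intro int; simp)[1],
        rule sum.cong[OF refl], subst Bochner_Integration.integral_sum, (intro int; simp)[1],
        rule sum.cong[OF refl], subst Bochner_Integration.integral_sum, (intro int; simp)[1]) simp
  also have "\<dots> = (\<Sum>i<d. \<Sum>j<d. \<Sum>k<d. E i j k * (LINT g|?M. (\<Sum>q<?n. \<Sum>a<d. \<Sum>b<d.
       mpow d (?X g) q j a * E a b k * mpow d (?X g) (?n - 1 - q) b i)))"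
    by (intro sum.cong refl arg_cong2[of _ _ _ _ "(*)"] integral_component_mpow_contr) auto
  also have "\<dots> = (LINT g|?M. (\<Sum>i<d. \<Sum>j<d. \<Sum>k<d. E i j k * (\<Sum>q<?n. \<Sum>a<d. \<Sum>b<d.
       mpow d (?X g) q j a * E a b k * mpow d (?X g) (?n - 1 - q) b i)))"
    by (subst Bochner_Integration.integral_sum, (intro int; simp)[1],
        rule sum.cong[OF refl], subst Bochner_Integration.integral_sum, (intro int; simp)[1],
        rule sum.cong[OF refl], subst Bochner_Integration.integral_sum, (intro int; simp)[1]) simp
  \<comment> \<open>A reordering of finite sums: with \<open>q\<close> and \<open>k\<close>
    outermost, the remaining sum is the trace of \<open>H X^q H X^r\<close> for the slice
    \<open>H\<close> at \<open>k\<close>.\<close>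
  also have "\<dots> = (LINT g|?M. (\<Sum>q<?n. \<Sum>k<d. ?S g q k))"
  proof (rule Bochner_Integration.integral_cong[OF refl])
    fix g
    let ?f = "\<lambda>i j k q a b. E i j k * (mpow d (?X g) q j a * E a b k * mpow d (?X g) (?n - 1 - q) b i)"
    have "(\<Sum>i<d. \<Sum>j<d. \<Sum>k<d. E i j k * (\<Sum>q<?n. \<Sum>a<d. \<Sum>b<d.
       mpow d (?X g) q j a * E a b k * mpow d (?X g) (?n - 1 - q) b i)) =
       (\<Sum>i<d. \<Sum>j<d. \<Sum>k<d. \<Sum>q<?n. \<Sum>a<d. \<Sum>b<d. ?f i j k q a b)"
      by (simp only: sum_distrib_left)
    also have "\<dots> = (\<Sum>(i, j, k, q, a, b) \<in> {..<d} \<times> {..<d} \<times> {..<d} \<times> {..<?n} \<times> {..<d} \<times> {..<d}. ?f i j k q a b)"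
      by (simp only: sum.cartesian_product)
    also have "\<dots> = (\<Sum>(q, k, i, a, j, b) \<in> {..<?n} \<times> {..<d} \<times> {..<d} \<times> {..<d} \<times> {..<d} \<times> {..<d}. ?f i j k q a b)"
      by (rule sum.reindex_bij_witness[where
            i = "\<lambda>(q, k, i, a, j, b). (i, j, k, q, a, b)" and
            j = "\<lambda>(i, j, k, q, a, b). (q, k, i, a, j, b)"]) auto
    also have "\<dots> = (\<Sum>q<?n. \<Sum>k<d. \<Sum>i<d. \<Sum>a<d. \<Sum>j<d. \<Sum>b<d. ?f i j k q a b)"
      by (simp only: sum.cartesian_product)
    also have "\<dots> = (\<Sum>q<?n. \<Sum>k<d. ?S g q k)"
      unfolding sum_product by (intro sum.cong refl) (simp add: mult_ac)
    finally show "(\<Sum>i<d. \<Sum>j<d. \<Sum>k<d. E i j k * (\<Sum>q<?n. \<Sum>a<d. \<Sum>b<d.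
       mpow d (?X g) q j a * E a b k * mpow d (?X g) (?n - 1 - q) b i)) = (\<Sum>q<?n. \<Sum>k<d. ?S g q k)" .
  qed
  also have "\<dots> \<le> (LINT g|?M. real ?n * \<tau>\<^sup>2 * tr d (mpow d (?X g) (2 * N)))"
  proof (rule integral_mono)
    show "integrable ?M (\<lambda>g. \<Sum>q<?n. \<Sum>k<d. ?S g q k)"
      by (intro int)
    show "integrable ?M (\<lambda>g. real ?n * \<tau>\<^sup>2 * tr d (mpow d (?X g) (2 * N)))"
      by (intro integrable_mult_right integrable_tr_mpow_contr)
    fix g
    obtain u lam where eb: "eigenbasis d (?X g) u lam"
      by (rule spectral_theorem[OF symmetric_contr[OF sym]])
    have "(\<Sum>k<d. ?S g q k) \<le> \<tau>\<^sup>2 * tr d (mpow d (?X g) (2 * N))" if "q < ?n" for q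
    proof -
      have "(\<Sum>k<d. ?S g q k) \<le>
          (\<Sum>k<d. \<Sum>l<d. lam l ^ (2 * N) * ip d (mv d (\<lambda>i j. E i j k) (u l)) (mv d (\<lambda>i j. E i j k) (u l)))"
        using that by (intro sum_mono trace_interlaced_powers_le[OF eb sym]) auto
      also have "\<dots> = (\<Sum>l<d. lam l ^ (2 * N) *
          (\<Sum>k<d. ip d (mv d (\<lambda>i j. E i j k) (u l)) (mv d (\<lambda>i j. E i j k) (u l))))"
        by (subst sum.swap) (simp add: sum_distrib_left)
      also have "\<dots> \<le> (\<Sum>l<d. lam l ^ (2 * N) * (\<tau>\<^sup>2 * ip d (u l) (u l)))"
        by (intro sum_mono mult_left_mono bound) (simp add: power_mult)
      also have "\<dots> = (\<Sum>l<d. \<tau>\<^sup>2 * lam l ^ (2 * N))"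
        using eigenbasisD(1)[OF eb] by (intro sum.cong) (auto simp: orthonormal_onD)
      also have "\<dots> = \<tau>\<^sup>2 * tr d (mpow d (?X g) (2 * N))"
        by (simp add: tr_mpow_spectral[OF eb] sum_distrib_left)
      finally show ?thesis .
    qed
    then have "(\<Sum>q<?n. \<Sum>k<d. ?S g q k) \<le> (\<Sum>q<?n. \<tau>\<^sup>2 * tr d (mpow d (?X g) (2 * N)))"
      by (intro sum_mono) auto
    then show "(\<Sum>q<?n. \<Sum>k<d. ?S g q k) \<le> real ?n * \<tau>\<^sup>2 * tr d (mpow d (?X g) (2 * N))"
      by (simp add: mult.assoc)
  qed
  finally show ?thesis by simp
qed

text \<open>Iterating the recursion produces the factors \<open>2 * j + 1\<close> for
  \<open>j < m\<close>, each at most \<open>2 * m\<close>.\<close>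

lemma trace_moment_le:
  fixes E :: tensor3
  assumes sym: "\<And>k. k < d \<Longrightarrow> symmetric_on d (\<lambda>i j. E i j k)"
    and bound: "\<And>x. (\<Sum>k<d. ip d (mv d (\<lambda>i j. E i j k) x) (mv d (\<lambda>i j. E i j k) x)) \<le> \<tau>\<^sup>2 * ip d x x"
  shows "(LINT g|std_gaussian d. tr d (mpow d (contr d E g) (2 * m))) \<le> real d * (real (2 * m) * \<tau>\<^sup>2) ^ m"
proof (induction m)
  case 0
  interpret prob_space "std_gaussian d" by (rule prob_space_std_gaussian)
  show ?case by (simp add: tr_def prob_space)
next
  case (Suc m)
  have "(LINT g|std_gaussian d. tr d (mpow d (contr d E g) (2 * Suc m))) \<le>
      real (2 * m + 1) * \<tau>\<^sup>2 * (LINT g|std_gaussian d. tr d (mpow d (contr d E g) (2 * m)))"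
    by (rule trace_moment_Suc[OF sym bound])
  also have "\<dots> \<le> real (2 * Suc m) * \<tau>\<^sup>2 * (real d * (real (2 * m) * \<tau>\<^sup>2) ^ m)"
    using tr_mpow_even_nonneg[OF symmetric_contr[OF sym]]
    by (intro mult_mono Suc.IH mult_right_mono) (auto intro!: integral_nonneg)
  also have "\<dots> \<le> real (2 * Suc m) * \<tau>\<^sup>2 * (real d * (real (2 * Suc m) * \<tau>\<^sup>2) ^ m)"
    by (intro mult_left_mono power_mono mult_right_mono) auto
  finally show ?case by (simp only: power_Suc mult_ac)
qed

section \<open>One-dimensional marginals\<close>

lemma distr_std_gaussian_component_borel:
  assumes "k < d"
  shows "distr (std_gaussian d) borel (\<lambda>g. g k) = gauss"
  using distr_std_gaussian_component[OF assms]
  by (subst (asm) distr_cong[of "std_gaussian d" "std_gaussian d" gauss borel]) auto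

lemma indep_vars_components:
  assumes "d > 0"
  shows "prob_space.indep_vars (std_gaussian d) (\<lambda>_. borel) (\<lambda>k g. g k) {..<d}"
proof -
  interpret prob_space "std_gaussian d" by (rule prob_space_std_gaussian)
  have sets: "sets (PiM {..<d} (\<lambda>_. borel)) = sets (std_gaussian d)"
    unfolding std_gaussian_def by (rule sets_PiM_cong) auto
  have "distr (std_gaussian d) (PiM {..<d} (\<lambda>_. borel)) (\<lambda>g. \<lambda>k\<in>{..<d}. g k) =
      distr (std_gaussian d) (std_gaussian d) (\<lambda>g. g)"
    by (rule distr_cong) (auto simp: sets std_gaussian_def space_PiM PiE_def extensional_restrict)
  also have "\<dots> = std_gaussian d" by simp
  also have "\<dots> = PiM {..<d} (\<lambda>k. distr (std_gaussian d) borel (\<lambda>g. g k))"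
    unfolding std_gaussian_def[of d]
    by (rule PiM_cong) (auto simp: distr_std_gaussian_component_borel[unfolded std_gaussian_def])
  finally show ?thesis
    using assms by (subst indep_vars_iff_distr_eq_PiM') (auto simp: measurable_std_gaussian_component)
qed

lemma distributed_linear_form:
  assumes a: "ip d a a = 1"
  shows "distributed (std_gaussian d) lborel (\<lambda>g. ip d g a) std_normal_density"
proof -
  interpret prob_space "std_gaussian d" by (rule prob_space_std_gaussian)
  \<comment> \<open>Coordinates with coefficient zero are left out, since a normal density needs a
    positive standard deviation.\<close>
  define J where "J = {k. k < d \<and> a k \<noteq> 0}"
  have J: "finite J" "J \<subseteq> {..<d}" by (auto simp: J_def)
  have sumJ: "(\<Sum>k<d. f k * a k) = (\<Sum>k\<in>J. f k * a k)" for f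
    by (rule sum.mono_neutral_right) (auto simp: J_def)
  have "J \<noteq> {}" using a sumJ[of a] by (auto simp: ip_def)
  then have "d > 0" by (auto simp: J_def)
  have indep: "indep_vars (\<lambda>_. borel) (\<lambda>k g. a k * g k) J"
    by (rule indep_vars_compose2[OF indep_vars_subset[OF indep_vars_components[OF \<open>d > 0\<close>] J(2)]]) auto
  have "distributed (std_gaussian d) lborel (\<lambda>g. g k) (normal_density 0 1)" if "k < d" for k
    using distr_std_gaussian_component_borel[OF that] measurable_std_gaussian_component[OF that]
    unfolding distributed_def by (auto cong: distr_cong)
  then have norm: "distributed (std_gaussian d) lborel (\<lambda>g. a k * g k) (normal_density 0 \<bar>a k\<bar>)" if "k \<in> J" for k
    using normal_density_affine[of "\<lambda>g. g k" 0 1 "a k" 0] that by (auto simp: J_def)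
  have "distributed (std_gaussian d) lborel (\<lambda>g. \<Sum>k\<in>J. a k * g k)
      (normal_density (\<Sum>k\<in>J. 0) (sqrt (\<Sum>k\<in>J. \<bar>a k\<bar>\<^sup>2)))"
    by (rule sum_indep_normal[OF J(1) \<open>J \<noteq> {}\<close> indep _ norm]) (auto simp: J_def)
  moreover have "(\<Sum>k\<in>J. \<bar>a k\<bar>\<^sup>2) = 1"
    using a sumJ[of a] by (simp add: ip_def power2_eq_square)
  moreover have "(\<Sum>k\<in>J. a k * g k) = ip d g a" for g
    using sumJ[of g] by (simp add: ip_def mult.commute)
  ultimately show ?thesis by simp
qed

lemma measurable_linear_form: "(\<lambda>g. ip d g a) \<in> borel_measurable (std_gaussian d)"
  unfolding ip_def
  by (intro borel_measurable_sum borel_measurable_times measurable_std_gaussian_component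
        borel_measurable_const) auto

lemma measure_linear_form:
  assumes "ip d a a = 1" "S \<in> sets borel"
  shows "measure (std_gaussian d) {g \<in> space (std_gaussian d). ip d g a \<in> S} = measure gauss S"
proof -
  have "measure gauss S = measure (distr (std_gaussian d) lborel (\<lambda>g. ip d g a)) S"
    by (simp add: distributed_distr_eq_density[OF distributed_linear_form[OF assms(1)]])
  also have "\<dots> = measure (std_gaussian d) ((\<lambda>g. ip d g a) -` S \<inter> space (std_gaussian d))"
    using assms(2) measurable_linear_form by (subst measure_distr) auto
  finally show ?thesis
    by (simp add: vimage_def Int_def conj_commute)
qed

text \<open>Beyond \<open>s\<close> the density is at most \<open>x / s\<close> times itself, and
  this product has an explicit antiderivative.\<close>

lemma gauss_tail:
  assumes "s > 0"
  shows "measure gauss {s<..} \<le> std_normal_density s / s"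
proof -
  interpret prob_space gauss by (rule prob_space_gauss)
  let ?f = "\<lambda>x. x / s * std_normal_density x" and ?F = "\<lambda>x. - std_normal_density x / s"
  have lim: "(?F \<longlongrightarrow> 0) at_top"
    unfolding std_normal_density_def using assms by real_asymp
  have "emeasure gauss {s<..} = (\<integral>\<^sup>+x. ennreal (std_normal_density x) * indicator {s<..} x \<partial>lborel)"
    by (subst emeasure_density) auto
  also have "\<dots> \<le> (\<integral>\<^sup>+x. ennreal (?f x) * indicator {s..} x \<partial>lborel)"
  proof (rule nn_integral_mono)
    fix x
    have "std_normal_density x \<le> ?f x" if "s < x"
      using that assms mult_right_mono[of 1 "x / s" "std_normal_density x"] by (simp add: normal_density_nonneg)
    then show "ennreal (std_normal_density x) * indicator {s<..} x \<le> ennreal (?f x) * indicator {s..} x"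
      by (auto split: split_indicator intro!: ennreal_leI)
  qed
  also have "\<dots> = ennreal (0 - ?F s)"
  proof (rule nn_integral_FTC_atLeast[OF _ _ _ lim])
    fix x assume "s \<le> x"
    show "(?F has_real_derivative ?f x) (at x)"
      unfolding std_normal_density_def using assms
      by (auto intro!: derivative_eq_intros simp: field_simps)
    show "0 \<le> ?f x" using \<open>s \<le> x\<close> assms by (simp add: normal_density_nonneg)
  qed simp
  finally show ?thesis
    using assms by (simp add: emeasure_eq_measure normal_density_nonneg)
qed

lemma gauss_interval:
  assumes "w \<ge> 0"
  shows "w * std_normal_density w \<le> measure gauss {0..w}"
proof -
  interpret prob_space gauss by (rule prob_space_gauss)
  have "ennreal (std_normal_density w * w) = (\<integral>\<^sup>+x. ennreal (std_normal_density w) * indicator {0..w} x \<partial>lborel)"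
    using assms by (subst nn_integral_cmult_indicator) (auto simp: ennreal_mult normal_density_nonneg)
  also have "\<dots> \<le> (\<integral>\<^sup>+x. ennreal (std_normal_density x) * indicator {0..w} x \<partial>lborel)"
    by (intro nn_integral_mono)
       (auto split: split_indicator intro!: ennreal_leI divide_right_mono power_mono simp: std_normal_density_def)
  also have "\<dots> = emeasure gauss {0..w}"
    by (subst emeasure_density) auto
  finally show ?thesis
    by (simp add: emeasure_eq_measure mult.commute)
qed

lemma linear_form_tail:
  assumes a: "ip d a a = 1" and "s > 0"
  shows "measure (std_gaussian d) {g \<in> space (std_gaussian d). s < \<bar>ip d g a\<bar>} \<le> 2 * std_normal_density s / s"
proof -
  interpret prob_space "std_gaussian d" by (rule prob_space_std_gaussian)
  let ?E = "\<lambda>a. {g \<in> space (std_gaussian d). ip d g a \<in> {s<..}}"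
  have neg: "ip d g (\<lambda>k. - a k) = - ip d g a" for g
    by (simp add: ip_def sum_negf)
  have a': "ip d (\<lambda>k. - a k) (\<lambda>k. - a k) = 1"
    using a by (simp add: ip_def)
  have meas: "?E b \<in> events" for b
    using measurable_linear_form[of d b] by measurable
  have "{g \<in> space (std_gaussian d). s < \<bar>ip d g a\<bar>} \<subseteq> ?E a \<union> ?E (\<lambda>k. - a k)"
    by (auto simp: neg abs_if split: if_splits)
  then have "prob {g \<in> space (std_gaussian d). s < \<bar>ip d g a\<bar>} \<le> prob (?E a \<union> ?E (\<lambda>k. - a k))"
    by (intro finite_measure_mono sets.Un meas)
  also have "\<dots> \<le> prob (?E a) + prob (?E (\<lambda>k. - a k))"
    by (intro measure_Un_le meas)
  also have "\<dots> = 2 * measure gauss {s<..}"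
    using measure_linear_form[OF a, of "{s<..}"] measure_linear_form[OF a', of "{s<..}"] by simp
  also have "\<dots> \<le> 2 * std_normal_density s / s"
    using gauss_tail[OF \<open>s > 0\<close>] by simp
  finally show ?thesis .
qed

section \<open>Translation of the Gaussian measure\<close>

text \<open>The exponential is the ratio of the densities at \<open>y + v\<close> and at
  \<open>y\<close>, so the weight undoes the translation.\<close>

lemma gauss_shift:
  assumes [measurable]: "A \<in> sets borel"
  shows "(\<integral>\<^sup>+y. ennreal (exp (- v * y - v\<^sup>2 / 2)) * indicator A (y + v) \<partial>gauss) = emeasure gauss A"
proof -
  have eq: "std_normal_density (v + 1 * y) = std_normal_density y * exp (- v * y - v\<^sup>2 / 2)" for y
    by (simp add: std_normal_density_def mult_exp_exp power2_eq_square field_simps)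
  have "emeasure gauss A = (\<integral>\<^sup>+y. ennreal (std_normal_density y) * indicator A y \<partial>lborel)"
    by (subst emeasure_density) auto
  also have "\<dots> = ennreal \<bar>1\<bar> * (\<integral>\<^sup>+y. ennreal (std_normal_density (v + 1 * y)) * indicator A (v + 1 * y) \<partial>lborel)"
    by (rule nn_integral_real_affine) auto
  also have "\<dots> = (\<integral>\<^sup>+y. ennreal (std_normal_density y) * (ennreal (exp (- v * y - v\<^sup>2 / 2)) * indicator A (y + v)) \<partial>lborel)"
    unfolding eq by (simp add: ennreal_mult' normal_density_nonneg mult.assoc add.commute)
  also have "\<dots> = (\<integral>\<^sup>+y. ennreal (exp (- v * y - v\<^sup>2 / 2)) * indicator A (y + v) \<partial>gauss)"
    by (subst nn_integral_density) auto
  finally show ?thesis by simp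
qed

text \<open>Points of the product space are \<open>undefined\<close> outside \<open>{..<d}\<close>,
  hence the restriction.\<close>

definition translate :: "nat \<Rightarrow> (nat \<Rightarrow> real) \<Rightarrow> (nat \<Rightarrow> real) \<Rightarrow> nat \<Rightarrow> real" where
  "translate d v g = (\<lambda>k\<in>{..<d}. g k + v k)"

lemma space_std_gaussian: "space (std_gaussian d) = PiE {..<d} (\<lambda>_. UNIV)"
  by (simp add: std_gaussian_def space_PiM)

lemma measurable_translate: "translate d v \<in> measurable (std_gaussian d) (std_gaussian d)"
proof -
  have "(\<lambda>g. \<lambda>k\<in>{..<d}. g k + v k) \<in> measurable (std_gaussian d) (PiM {..<d} (\<lambda>_. gauss))"
    by (rule measurable_restrict)
       (use measurable_std_gaussian_component in \<open>auto cong: measurable_cong_sets\<close>)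
  then show ?thesis
    by (simp add: translate_def[abs_def] std_gaussian_def[symmetric])
qed

text \<open>The Cameron-Martin formula. A product measure is determined by boxes, on which the
  integral factors into instances of \<open>gauss_shift\<close>.\<close>

lemma std_gaussian_translate:
  "density (distr (std_gaussian d) (std_gaussian d) (translate d v))
     (\<lambda>g. \<Prod>k<d. ennreal (exp (- v k * (g k - v k) - (v k)\<^sup>2 / 2))) = std_gaussian d"
    (is "density ?D ?r = _")
proof -
  interpret product_sigma_finite "\<lambda>_ :: nat. gauss" by (rule product_sigma_finite_gauss)
  let ?M = "std_gaussian d"
  note [measurable] = measurable_translate measurable_std_gaussian_component
  have r: "?r \<in> borel_measurable ?M"
    by (intro borel_measurable_prod_ennreal) (use measurable_std_gaussian_component in auto)
  have "density ?D ?r = PiM {..<d} (\<lambda>_. gauss)"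
  proof (rule PiM_eqI)
    show "sets (density ?D ?r) = sets (PiM {..<d} (\<lambda>_. gauss))"
      by (simp add: std_gaussian_def)
    fix A :: "nat \<Rightarrow> real set"
    assume A: "\<And>k. k \<in> {..<d} \<Longrightarrow> A k \<in> sets gauss"
    have B: "PiE {..<d} A \<in> sets ?M"
      unfolding std_gaussian_def using A by (intro sets_PiM_I_finite) auto
    have "emeasure (density ?D ?r) (PiE {..<d} A) = (\<integral>\<^sup>+g. ?r g * indicator (PiE {..<d} A) g \<partial>?D)"
      using B r by (subst emeasure_density) auto
    also have "\<dots> = (\<integral>\<^sup>+g. ?r (translate d v g) * indicator (PiE {..<d} A) (translate d v g) \<partial>?M)"
      using B r by (subst nn_integral_distr) auto
    also have "\<dots> = (\<integral>\<^sup>+g. (\<Prod>k<d. ennreal (exp (- v k * g k - (v k)\<^sup>2 / 2)) * indicator (A k) (g k + v k)) \<partial>?M)"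
    proof (rule nn_integral_cong)
      fix g
      have "indicator (PiE {..<d} A) (translate d v g) = (\<Prod>k<d. indicator (A k) (g k + v k) :: ennreal)"
      proof (cases "\<forall>k<d. g k + v k \<in> A k")
        case True
        then show ?thesis by (auto simp: indicator_def translate_def)
      next
        case False
        then obtain k where k: "k < d" "g k + v k \<notin> A k" by auto
        then have "translate d v g \<notin> PiE {..<d} A" by (auto simp: translate_def PiE_iff)
        moreover have "(\<Prod>k<d. indicator (A k) (g k + v k) :: ennreal) = 0"
          using k by (intro prod_zero bexI[of _ k]) auto
        ultimately show ?thesis by simp
      qed
      then show "?r (translate d v g) * indicator (PiE {..<d} A) (translate d v g) =
         (\<Prod>k<d. ennreal (exp (- v k * g k - (v k)\<^sup>2 / 2)) * indicator (A k) (g k + v k))"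
        by (simp add: prod.distrib translate_def)
    qed
    also have "\<dots> = (\<Prod>k<d. \<integral>\<^sup>+y. ennreal (exp (- v k * y - (v k)\<^sup>2 / 2)) * indicator (A k) (y + v k) \<partial>gauss)"
      unfolding std_gaussian_def
      by (rule product_nn_integral_prod) (use A in auto)
    also have "\<dots> = (\<Prod>k<d. emeasure gauss (A k))"
      using A by (intro prod.cong refl gauss_shift) auto
    finally show "emeasure (density ?D ?r) (PiE {..<d} A) = (\<Prod>k<d. emeasure gauss (A k))" .
  qed simp
  then show ?thesis by (simp add: std_gaussian_def)
qed

text \<open>At the translate of \<open>g\<close> the Cameron-Martin weight is
  \<open>exp (- ip d g v - ip d v v / 2)\<close>, and on \<open>B\<close> its exponent is bounded
  below through \<open>c\<close>.\<close>

lemma measure_translate_ge: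
  assumes B: "B \<in> sets (std_gaussian d)" and A: "A \<in> sets (std_gaussian d)"
    and sub: "\<And>g. g \<in> B \<Longrightarrow> translate d v g \<in> A"
    and le: "\<And>g. g \<in> B \<Longrightarrow> ip d g v \<le> c"
  shows "exp (- c - ip d v v / 2) * measure (std_gaussian d) B \<le> measure (std_gaussian d) A"
proof -
  interpret prob_space "std_gaussian d" by (rule prob_space_std_gaussian)
  let ?M = "std_gaussian d"
  let ?r = "\<lambda>g :: nat \<Rightarrow> real. \<Prod>k<d. ennreal (exp (- v k * (g k - v k) - (v k)\<^sup>2 / 2))"
  note [measurable] = measurable_translate
  have r: "?r \<in> borel_measurable ?M"
    by (intro borel_measurable_prod_ennreal) (use measurable_std_gaussian_component in auto)
  have "ennreal (exp (- c - ip d v v / 2) * prob B) = (\<integral>\<^sup>+g. ennreal (exp (- c - ip d v v / 2)) * indicator B g \<partial>?M)"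
    using B by (subst nn_integral_cmult_indicator) (auto simp: emeasure_eq_measure ennreal_mult)
  also have "\<dots> \<le> (\<integral>\<^sup>+g. ?r (translate d v g) * indicator A (translate d v g) \<partial>?M)"
  proof (rule nn_integral_mono)
    fix g
    show "ennreal (exp (- c - ip d v v / 2)) * indicator B g \<le> ?r (translate d v g) * indicator A (translate d v g)"
    proof (cases "g \<in> B")
      case True
      have "?r (translate d v g) = ennreal (\<Prod>k<d. exp (- v k * g k - (v k)\<^sup>2 / 2))"
        by (subst prod_ennreal) (auto simp: translate_def)
      also have "(\<Prod>k<d. exp (- v k * g k - (v k)\<^sup>2 / 2)) = exp (- ip d g v - ip d v v / 2)"
        by (subst exp_sum[symmetric])
           (auto simp: ip_def sum_subtractf sum_negf power2_eq_square sum_divide_distrib mult.commute)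
      finally show ?thesis
        using True sub[OF True] le[OF True] by (auto intro!: ennreal_leI)
    qed simp
  qed
  also have "\<dots> = (\<integral>\<^sup>+g. ?r g * indicator A g \<partial>distr ?M ?M (translate d v))"
    using A r by (subst nn_integral_distr) auto
  also have "\<dots> = emeasure (density (distr ?M ?M (translate d v)) ?r) A"
    using A r by (subst emeasure_density) auto
  also have "\<dots> = ennreal (prob A)"
    unfolding std_gaussian_translate by (rule emeasure_eq_measure)
  finally show ?thesis by simp
qed

section \<open>Eigenvalues and eigenvectors of a perturbed diagonal matrix\<close>

lemma quadratic_form_eigenvector:
  assumes "\<And>i. i < d \<Longrightarrow> mv d S v i = l * v i"
  shows "ip d (mv d S v) y = l * ip d v y"
  unfolding ip_scale_left[symmetric] using assms by (intro ip_cong) auto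

text \<open>The deterministic half of the argument, for a fixed sample: \<open>w\<close> holds its
  coefficients along the \<open>a l\<close>, \<open>X\<close> is the contracted error tensor,
  \<open>t\<close> and \<open>s\<close> are the levels of the boosted and of the other coefficients,
  and \<open>e\<close> bounds the operator norm of the noise.\<close>

locale perturbed_diagonal =
  fixes d :: nat and I :: "'i set" and p :: 'i and a :: "'i \<Rightarrow> nat \<Rightarrow> real" and w :: "'i \<Rightarrow> real"
    and X M :: "nat \<Rightarrow> nat \<Rightarrow> real" and t s e :: real
  assumes finite_I: "finite I" and orthonormal: "orthonormal_on d I a" and p: "p \<in> I"
    and M_sym: "symmetric_on d M"
    and M_eq: "\<And>i j. i < d \<Longrightarrow> j < d \<Longrightarrow> M i j = (\<Sum>l\<in>I. w l * a l i * a l j) + X i j"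
    and w_p: "t \<le> w p" and t_nonneg: "0 \<le> t"
    and w_other: "\<And>l. l \<in> I - {p} \<Longrightarrow> \<bar>w l\<bar> \<le> s" and s_nonneg: "0 \<le> s"
    and X_le: "\<And>x y. \<bar>ip d (mv d X x) y\<bar> \<le> e * sqrt (ip d x x) * sqrt (ip d y y)"
begin

lemma a_p: "ip d (a p) (a p) = 1"
  using orthonormal_onD[OF orthonormal p p] by simp

lemma form_eq: "ip d (mv d M x) y = (\<Sum>l\<in>I. w l * ip d x (a l) * ip d y (a l)) + ip d (mv d X x) y"
proof -
  have "mv d M x i = (\<Sum>l\<in>I. w l * ip d x (a l) * a l i) + mv d X x i" if "i < d" for i
  proof -
    have "mv d M x i = (\<Sum>j<d. \<Sum>l\<in>I. w l * (x j * a l j) * a l i) + mv d X x i"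
      unfolding mv_def sum.distrib[symmetric] using M_eq[OF that]
      by (intro sum.cong refl) (simp add: algebra_simps sum_distrib_left)
    also have "(\<Sum>j<d. \<Sum>l\<in>I. w l * (x j * a l j) * a l i) = (\<Sum>l\<in>I. w l * ip d x (a l) * a l i)"
      by (subst sum.swap) (simp add: ip_def sum_distrib_left sum_distrib_right)
    finally show ?thesis .
  qed
  then have "ip d (mv d M x) y = ip d (\<lambda>i. (\<Sum>l\<in>I. w l * ip d x (a l) * a l i) + mv d X x i) y"
    by (intro ip_cong) auto
  then show ?thesis
    by (simp add: ip_linear ip_commute[of d "a _" y])
qed

lemma form_split: "ip d (mv d M x) y = w p * ip d x (a p) * ip d y (a p) +
    (\<Sum>l\<in>I - {p}. w l * ip d x (a l) * ip d y (a l)) + ip d (mv d X x) y"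
  unfolding form_eq by (subst sum.remove[OF finite_I p]) simp

lemma other_sum_le: "\<bar>\<Sum>l\<in>I - {p}. w l * ip d x (a l) * ip d x (a l)\<bar> \<le> s * ip d x x"
proof -
  have "\<bar>\<Sum>l\<in>I - {p}. w l * ip d x (a l) * ip d x (a l)\<bar> \<le> (\<Sum>l\<in>I - {p}. \<bar>w l * ip d x (a l) * ip d x (a l)\<bar>)"
    by (rule sum_abs)
  also have "\<dots> = (\<Sum>l\<in>I - {p}. \<bar>w l\<bar> * (ip d x (a l))\<^sup>2)"
    by (simp add: abs_mult power2_eq_square mult.assoc abs_mult_self_eq)
  also have "\<dots> \<le> (\<Sum>l\<in>I - {p}. s * (ip d x (a l))\<^sup>2)"
    using w_other by (intro sum_mono mult_right_mono) auto
  also have "\<dots> \<le> (\<Sum>l\<in>I. s * (ip d x (a l))\<^sup>2)"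
    using finite_I s_nonneg by (intro sum_mono2) auto
  also have "\<dots> = s * (\<Sum>l\<in>I. (ip d x (a l))\<^sup>2)"
    by (simp add: sum_distrib_left)
  also have "\<dots> \<le> s * ip d x x"
    using Bessel_inequality[OF finite_I orthonormal] s_nonneg by (intro mult_left_mono)
  finally show ?thesis .
qed

lemma X_self_le: "\<bar>ip d (mv d X x) x\<bar> \<le> e * ip d x x"
  using X_le[of x x] ip_self_nonneg[of d x] by (simp add: mult.assoc)

text \<open>The Rayleigh quotient is tested at \<open>a p\<close>, where the other rank-one terms
  vanish.\<close>

lemma top_ge:
  assumes eb: "eigenbasis d M u lam" and top: "\<And>k. k < d \<Longrightarrow> lam k \<le> l"
  shows "t - e \<le> l"
proof -
  have zero: "(\<Sum>l\<in>I - {p}. w l * ip d (a p) (a l) * ip d (a p) (a l)) = 0"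
    using orthonormal_onD[OF orthonormal p] by (intro sum.neutral) auto
  have "t - e \<le> ip d (mv d M (a p)) (a p)"
    unfolding form_split using zero w_p X_self_le[of "a p"] a_p by simp
  also have "\<dots> = (\<Sum>k<d. lam k * (ip d (a p) (u k) * ip d (a p) (u k)))"
    unfolding quadratic_form_spectral[OF eb M_sym] by (simp add: mult.assoc)
  also have "\<dots> \<le> (\<Sum>k<d. l * (ip d (a p) (u k) * ip d (a p) (u k)))"
    using top by (intro sum_mono mult_right_mono) auto
  also have "\<dots> = l * ip d (a p) (a p)"
    by (subst Parseval[OF eigenbasisD(1)[OF eb], of "a p" "a p"]) (simp add: sum_distrib_left)
  finally show ?thesis using a_p by simp
qed

text \<open>The upper bound is a two-dimensional Courant-Fischer argument: on the span of
  \<open>u m\<close> and \<open>u k\<close> the form is at least \<open>lam k\<close>, while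
  orthogonally to \<open>a p\<close> it is at most \<open>s + e\<close>, relative to the squared
  norm. The lower bound tests \<open>u k\<close> itself, where the term of \<open>p\<close> is
  nonnegative.\<close>

lemma other_le:
  assumes eb: "eigenbasis d M u lam" and m: "m < d" "\<And>k. k < d \<Longrightarrow> lam k \<le> lam m"
    and k: "k < d" "k \<noteq> m"
  shows "\<bar>lam k\<bar> \<le> s + e"
proof -
  note u = eigenbasisD(1)[OF eb]
  have uu: "ip d (u k) (u k) = 1" "ip d (u m) (u m) = 1" "ip d (u k) (u m) = 0" "ip d (u m) (u k) = 0"
    using u k m by (auto simp: orthonormal_onD)
  have ev: "ip d (mv d M (u j)) y = lam j * ip d (u j) y" if "j < d" for j y
    using eigenbasisD(2)[OF eb that] by (rule quadratic_form_eigenvector)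
  \<comment> \<open>The span of \<open>u m\<close> and \<open>u k\<close> contains a nonzero vector orthogonal to \<open>a p\<close>.\<close>
  obtain \<alpha> \<beta> where ab: "\<alpha> * ip d (u m) (a p) + \<beta> * ip d (u k) (a p) = 0" "\<alpha>\<^sup>2 + \<beta>\<^sup>2 > 0"
  proof (cases "ip d (u k) (a p) = 0")
    case True
    show ?thesis by (rule that[of 0 1]) (auto simp: True)
  next
    case False
    show ?thesis
      by (rule that[of "ip d (u k) (a p)" "- ip d (u m) (a p)"]) (use False in \<open>auto simp: add_pos_nonneg\<close>)
  qed
  define x where "x = (\<lambda>i. \<alpha> * u m i + \<beta> * u k i)"
  have xp: "ip d x (a p) = 0" and xx: "ip d x x = \<alpha>\<^sup>2 + \<beta>\<^sup>2"
    using ab(1) uu by (simp_all add: x_def ip_linear power2_eq_square)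
  have mvx: "mv d M x = (\<lambda>i. \<alpha> * mv d M (u m) i + \<beta> * mv d M (u k) i)"
    by (simp add: mv_def x_def algebra_simps sum.distrib sum_distrib_left)
  have "ip d (mv d M x) x = \<alpha>\<^sup>2 * lam m + \<beta>\<^sup>2 * lam k"
    unfolding mvx by (simp add: ip_linear ev k m, simp add: x_def ip_linear uu power2_eq_square)
  then have "lam k * (\<alpha>\<^sup>2 + \<beta>\<^sup>2) \<le> ip d (mv d M x) x"
    using mult_left_mono[OF m(2)[OF k(1)], of "\<alpha>\<^sup>2"] by (simp add: algebra_simps)
  also have "\<dots> \<le> (s + e) * (\<alpha>\<^sup>2 + \<beta>\<^sup>2)"
    unfolding form_split[of x x] using xp other_sum_le[of x] X_self_le[of x] xx by (simp add: algebra_simps)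
  finally have upper: "lam k \<le> s + e"
    using ab(2) by (simp add: mult_le_cancel_right)
  have "lam k = ip d (mv d M (u k)) (u k)"
    using ev[OF k(1)] uu by simp
  moreover have "0 \<le> w p * ip d (u k) (a p) * ip d (u k) (a p)"
    using w_p t_nonneg by (simp add: mult.assoc)
  ultimately have "- (s + e) \<le> lam k"
    unfolding form_split using other_sum_le[of "u k"] X_self_le[of "u k"] uu by simp
  with upper show ?thesis by linarith
qed

text \<open>Davis-Kahan for one vector: pair the eigenvalue equation with the part \<open>y\<close>
  of \<open>v\<close> orthogonal to \<open>a p\<close>. The square root is the norm of
  \<open>y\<close>, the sine of the angle between \<open>v\<close> and \<open>a p\<close>.\<close>

lemma eigenvector_component_le:
  assumes v: "ip d v v = 1" and ev: "\<And>i. i < d \<Longrightarrow> mv d M v i = l * v i"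
  shows "(l - s) * sqrt (1 - (ip d v (a p))\<^sup>2) \<le> e"
proof -
  define c where "c = ip d v (a p)"
  define y where "y = (\<lambda>i. v i - c * a p i)"
  have yp: "ip d y (a p) = 0" using a_p by (simp add: y_def ip_linear c_def)
  have vy: "ip d v y = 1 - c\<^sup>2" using v by (simp add: y_def ip_linear c_def power2_eq_square)
  have yy: "ip d y y = 1 - c\<^sup>2"
  proof -
    have "ip d y y = ip d v y - c * ip d (a p) y" by (subst (1) y_def) (simp add: ip_linear)
    then show ?thesis using yp vy by (simp add: ip_commute)
  qed
  have ya: "ip d v (a l) = ip d y (a l)" if "l \<in> I - {p}" for l
    using that orthonormal_onD[OF orthonormal p, of l] by (auto simp: y_def ip_linear)
  have "l * ip d y y = ip d (mv d M v) y"
    using quadratic_form_eigenvector[OF ev, of y] vy yy by simp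
  also have "\<dots> = (\<Sum>l\<in>I - {p}. w l * ip d y (a l) * ip d y (a l)) + ip d (mv d X v) y"
    unfolding form_split using yp ya by simp
  also have "\<dots> \<le> s * ip d y y + e * sqrt (ip d y y)"
    using other_sum_le[of y] X_le[of v y] v by simp
  finally have *: "(l - s) * ip d y y \<le> e * sqrt (ip d y y)"
    by (simp add: algebra_simps)
  have "0 \<le> e" using X_self_le[of "a p"] a_p by simp
  show ?thesis
  proof (cases "ip d y y = 0")
    case True
    then show ?thesis using yy \<open>0 \<le> e\<close> by (simp add: c_def)
  next
    case False
    then have pos: "sqrt (ip d y y) > 0"
      using ip_self_nonneg[of d y] by (simp add: less_le)
    have "(l - s) * sqrt (ip d y y) * sqrt (ip d y y) \<le> e * sqrt (ip d y y)"
      using * ip_self_nonneg[of d y] by (simp add: mult.assoc)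
    then have "(l - s) * sqrt (ip d y y) \<le> e" using pos by simp
    then show ?thesis by (simp add: yy c_def)
  qed
qed

end

section \<open>Eigenvalues counted with multiplicity\<close>

lemma eigenvalues_eigenbasis:
  assumes eb: "eigenbasis d S u lam"
  shows "eigenvalues (Matrix.mat d d (\<lambda>(i, j). S i j)) = image_mset lam (mset_set {..<d})"
proof -
  let ?A = "Matrix.mat d d (\<lambda>(i, j). S i j)"
  define P where "P = Matrix.mat d d (\<lambda>(i, k). u k i)"
  define Q where "Q = Matrix.mat d d (\<lambda>(k, i). u k i)"
  define D where "D = Matrix.mat d d (\<lambda>(i, j). if i = j then lam i else 0)"
  note [simp] = scalar_prod_def
  \<comment> \<open>The spectral form of the zeroth power is the completeness relation of the
    eigenbasis; that of the first power recovers \<open>S\<close> further down.\<close>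
  have "P * Q = 1\<^sub>m d"
    using mpow_spectral[OF eb, of _ _ 0]
    by (intro eq_matI) (auto simp: P_def Q_def lessThan_atLeast0)
  moreover have "Q * P = 1\<^sub>m d"
    using orthonormal_onD[OF eigenbasisD(1)[OF eb]]
    by (intro eq_matI) (auto simp: P_def Q_def ip_def lessThan_atLeast0)
  moreover have "?A = P * D * Q"
  proof (rule eq_matI)
    fix i j assume "i < dim_row (P * D * Q)" "j < dim_col (P * D * Q)"
    then have ij: "i < d" "j < d" by (auto simp: P_def Q_def)
    have "(P * D) $$ (i, k) = lam k * u k i" if "k < d" for k
      using that ij by (simp add: P_def D_def if_distrib[of "\<lambda>z. _ * z"] mult.commute cong: if_cong)
    then have "(P * D * Q) $$ (i, j) = (\<Sum>k<d. lam k * u k i * u k j)"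
      using ij by (simp add: P_def D_def Q_def lessThan_atLeast0 del: index_mult_mat(1))
         (subst index_mult_mat(1), auto simp: P_def D_def Q_def)
    also have "\<dots> = mpow d S 1 i j"
      using mpow_spectral[OF eb ij, of 1] by simp
    also have "\<dots> = S i j"
      using ij by (simp add: if_distrib[of "\<lambda>z. _ * z"] cong: if_cong)
    finally show "?A $$ (i, j) = (P * D * Q) $$ (i, j)" using ij by simp
  qed (auto simp: P_def Q_def)
  ultimately have "similar_mat ?A D"
    by (intro similar_matI[of _ _ P Q d]) (auto simp: P_def Q_def D_def)
  then have "char_poly ?A = char_poly D"
    by (rule char_poly_similar)
  also have "\<dots> = (\<Prod>x\<leftarrow>diag_mat D. [:- x, 1:])"
    by (rule char_poly_upper_triangular[of _ d]) (auto simp: D_def)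
  also have "diag_mat D = map lam [0..<d]"
    by (auto simp: diag_mat_def D_def)
  finally have "proots (char_poly ?A) = proots (\<Prod>x\<leftarrow>map lam [0..<d]. [:- x, 1:])"
    by simp
  also have "\<dots> = (\<Sum>x\<leftarrow>map lam [0..<d]. {#x#})"
    by (subst proots_prod_list[of "map (\<lambda>x. [:- x, 1:]) _", simplified]) (auto simp: o_def)
  also have "\<dots> = mset (map lam [0..<d])"
    by (induction d) auto
  also have "\<dots> = image_mset lam (mset_set {..<d})"
    by (simp add: mset_map lessThan_atLeast0 del: mset_upt) (simp add: mset_upt)
  finally show ?thesis by (simp add: eigenvalues_def)
qed

text \<open>Deleting one copy of the largest value from the multiset is deleting the index
  \<open>m\<close>; a repeated maximum stays present at another index.\<close>

lemma top_and_second_eigenvalue: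
  assumes eb: "eigenbasis d S u lam" and "d \<ge> 2"
  obtains m where "m < d" "\<And>k. k < d \<Longrightarrow> lam k \<le> lam m"
    "top_eigenvalue (Matrix.mat d d (\<lambda>(i, j). S i j)) = lam m"
    "second_abs_eigenvalue (Matrix.mat d d (\<lambda>(i, j). S i j)) = Max ((\<lambda>k. \<bar>lam k\<bar>) ` ({..<d} - {m}))"
proof -
  let ?A = "Matrix.mat d d (\<lambda>(i, j). S i j)"
  have ne: "{..<d} \<noteq> {}" using \<open>d \<ge> 2\<close> by (simp add: lessThan_empty_iff)
  have "Max (lam ` {..<d}) \<in> lam ` {..<d}" using ne by (intro Max_in) auto
  then obtain m where m: "m < d" "Max (lam ` {..<d}) = lam m" by auto
  have top: "top_eigenvalue ?A = lam m"
    by (simp add: top_eigenvalue_def eigenvalues_eigenbasis[OF eb] m)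
  have "mset_set {..<d} = {#m#} + mset_set ({..<d} - {m})"
    using m(1) by (simp add: mset_set.remove)
  then have "eigenvalues ?A - {#lam m#} = image_mset lam (mset_set ({..<d} - {m}))"
    by (simp add: eigenvalues_eigenbasis[OF eb])
  then have "second_abs_eigenvalue ?A = Max ((\<lambda>k. \<bar>lam k\<bar>) ` ({..<d} - {m}))"
    by (simp add: second_abs_eigenvalue_def top image_image)
  moreover have "lam k \<le> lam m" if "k < d" for k
    unfolding m(2)[symmetric] using that by (intro Max_ge) auto
  ultimately show ?thesis by (intro that[OF m(1) _ top])
qed

section \<open>Probability of the good event\<close>

lemma measurable_tr_mpow_contr [measurable]:
  "(\<lambda>g. tr d (mpow d (contr d E g) n)) \<in> borel_measurable (std_gaussian d)"
  using integrable_tr_mpow_contr by (rule borel_measurable_integrable)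

text \<open>Markov's inequality for the trace. The dimension enters only as a prefactor, which
  \<open>c ^ m\<close> absorbs once \<open>m\<close> is of order \<open>ln d\<close>.\<close>

lemma trace_tail:
  fixes E :: tensor3
  assumes sym: "\<And>k. k < d \<Longrightarrow> symmetric_on d (\<lambda>i j. E i j k)"
    and bound: "\<And>x. (\<Sum>k<d. ip d (mv d (\<lambda>i j. E i j k) x) (mv d (\<lambda>i j. E i j k) x)) \<le> \<tau>\<^sup>2 * ip d x x"
    and "m > 0" "c > 0"
  shows "measure (std_gaussian d) {g \<in> space (std_gaussian d). (c * (real (2 * m) * \<tau>\<^sup>2)) ^ m < tr d (mpow d (contr d E g) (2 * m))}
    \<le> real d / c ^ m"
proof -
  interpret prob_space "std_gaussian d" by (rule prob_space_std_gaussian)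
  let ?u = "\<lambda>g. tr d (mpow d (contr d E g) (2 * m))" and ?b = "real (2 * m) * \<tau>\<^sup>2"
  have nonneg: "0 \<le> ?u g" for g
    by (rule tr_mpow_even_nonneg[OF symmetric_contr[OF sym]])
  have E: "expectation ?u \<le> real d * ?b ^ m"
    by (rule trace_moment_le[OF sym bound])
  show ?thesis
  proof (cases "\<tau> = 0")
    \<comment> \<open>Markov's inequality needs a positive threshold. For \<open>\<tau> = 0\<close>
      the trace has expectation zero and so vanishes almost everywhere.\<close>
    case True
    with E \<open>m > 0\<close> have "expectation ?u \<le> 0" by (simp add: power_0_left)
    then have "expectation ?u = 0"
      using nonneg by (intro antisym integral_nonneg) auto
    then have "AE g in std_gaussian d. ?u g = 0"
      using integral_nonneg_eq_0_iff_AE[OF integrable_tr_mpow_contr] nonneg by auto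
    then have "prob {g \<in> space (std_gaussian d). (c * ?b) ^ m < ?u g} = 0"
      using True \<open>m > 0\<close> by (subst prob_eq_0) (auto simp: power_0_left)
    then show ?thesis using \<open>c > 0\<close> by simp
  next
    case False
    then have b: "?b > 0" using \<open>m > 0\<close> by simp
    then have cb: "(c * ?b) ^ m > 0" using \<open>c > 0\<close> by simp
    have "prob {g \<in> space (std_gaussian d). (c * ?b) ^ m < ?u g} \<le>
        prob {g \<in> space (std_gaussian d). ?u g \<ge> (c * ?b) ^ m}"
      by (intro finite_measure_mono) auto
    also have "\<dots> \<le> expectation ?u / (c * ?b) ^ m"
      by (rule integral_Markov_inequality_measure[OF integrable_tr_mpow_contr sets.top _ cb])
         (use nonneg in auto)
    also have "\<dots> \<le> (real d * ?b ^ m) / (c * ?b) ^ m"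
      using E cb by (intro divide_right_mono) auto
    also have "\<dots> = real d / c ^ m"
      using False b by (simp add: power_mult_distrib)
    finally show ?thesis .
  qed
qed

text \<open>The trace condition stands in for the bound \<open>r\<close> on the operator norm of the
  contracted \<open>E\<close>; being polynomial in \<open>g\<close>, it is visibly measurable. The
  upper end \<open>w\<close> of the window limits the cost of the later translation.\<close>

definition good_event ::
  "nat \<Rightarrow> 'i set \<Rightarrow> 'i \<Rightarrow> ('i \<Rightarrow> nat \<Rightarrow> real) \<Rightarrow> tensor3 \<Rightarrow> real \<Rightarrow> real \<Rightarrow> nat \<Rightarrow> real \<Rightarrow> (nat \<Rightarrow> real) set" where
  "good_event d I p a E w s m r = {g \<in> space (std_gaussian d).
     0 \<le> ip d g (a p) \<and> ip d g (a p) \<le> w \<and> (\<forall>l\<in>I - {p}. \<bar>ip d g (a l)\<bar> \<le> s) \<and>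
     tr d (mpow d (contr d E g) (2 * m)) \<le> r ^ (2 * m)}"

lemma sets_good_event:
  assumes "finite I"
  shows "good_event d I p a E w s m r \<in> sets (std_gaussian d)"
proof -
  note [measurable] = measurable_linear_form
  have "countable (I - {p})" using assms by (simp add: countable_finite)
  then show ?thesis unfolding good_event_def by measurable
qed

lemma std_normal_density_le:
  assumes "s > 0" "s\<^sup>2 / 2 = ln y" "y > 0"
  shows "2 * std_normal_density s / s \<le> 1 / (y * s)"
proof -
  have "sqrt (2 * pi) \<ge> sqrt (2\<^sup>2)"
    using pi_ge_two by (intro real_sqrt_le_mono) (simp add: power2_eq_square)
  then have "2 / sqrt (2 * pi) \<le> 1" by simp
  then have "2 / sqrt (2 * pi) * (exp (- s\<^sup>2 / 2) / s) \<le> 1 * (exp (- s\<^sup>2 / 2) / s)"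
    using assms by (intro mult_right_mono) auto
  moreover have "exp (- s\<^sup>2 / 2) = 1 / y"
    using assms by (simp add: exp_minus inverse_eq_divide)
  ultimately show ?thesis
    by (simp add: std_normal_density_def mult_ac)
qed

lemma std_normal_density_ge:
  assumes "0 \<le> x" "x \<le> 1 / 2"
  shows "3 / 10 \<le> std_normal_density x"
proof -
  have "x\<^sup>2 \<le> (1 / 2)\<^sup>2" using assms by (intro power_mono) auto
  then have "7 / 8 \<le> 1 + (- x\<^sup>2 / 2)" by (simp add: power2_eq_square)
  also have "\<dots> \<le> exp (- x\<^sup>2 / 2)" by (rule exp_ge_add_one_self)
  finally have e: "7 / 8 \<le> exp (- x\<^sup>2 / 2)" .
  \<comment> \<open>By \<open>pi < 4\<close> it suffices that \<open>sqrt 8 <= 35 / 12\<close>, and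
    this rational makes \<open>12 / 35 * (7 / 8)\<close> equal to \<open>3 / 10\<close>.\<close>
  have "sqrt (2 * pi) \<le> 35 / 12"
    using pi_less_4 by (intro real_le_lsqrt) (auto simp: power2_eq_square)
  then have "1 / (35 / 12) \<le> 1 / sqrt (2 * pi)"
    by (intro divide_left_mono) auto
  then have "12 / 35 \<le> 1 / sqrt (2 * pi)"
    by simp
  then have "12 / 35 * (7 / 8) \<le> 1 / sqrt (2 * pi) * exp (- x\<^sup>2 / 2)"
    using e by (intro mult_mono) auto
  then show ?thesis by (simp add: std_normal_density_def)
qed

text \<open>The window for \<open>ip d g (a p)\<close> has probability at least
  \<open>1 / (5 * s)\<close>; the other coefficients and the trace each violate their bounds with
  probability at most \<open>1 / (16 * s)\<close>. What remains is enough, as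
  \<open>1 / 5 - 1 / 8 >= 1 / 16\<close>.\<close>

lemma good_event_prob:
  fixes E :: tensor3
  assumes I: "finite I" "orthonormal_on d I a" "p \<in> I" and "d \<ge> 2"
    and sym: "\<And>k. k < d \<Longrightarrow> symmetric_on d (\<lambda>i j. E i j k)"
    and bound: "\<And>x. (\<Sum>k<d. ip d (mv d (\<lambda>i j. E i j k) x) (mv d (\<lambda>i j. E i j k) x)) \<le> \<tau>\<^sup>2 * ip d x x"
    and s: "s = sqrt (2 * ln (16 * real d))" and t: "s \<le> t" "t \<le> sqrt 2 * s"
    and m: "ln (16 * real d) \<le> real m"
    and r: "r\<^sup>2 = exp 3 * (real (2 * m) * \<tau>\<^sup>2)"
  shows "1 / (16 * s) \<le> measure (std_gaussian d) (good_event d I p a E (1 / t) s m r)"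
proof -
  interpret prob_space "std_gaussian d" by (rule prob_space_std_gaussian)
  let ?S = "space (std_gaussian d)" and ?y = "16 * real d"
  note [measurable] = measurable_linear_form
  have y: "?y \<ge> 32" using \<open>d \<ge> 2\<close> by simp
  have "ln ?y > 2"
  proof -
    have "exp (2 :: real) = exp 1 * exp 1" by (simp add: mult_exp_exp)
    also have "\<dots> \<le> 3 * 3" using exp_le by (intro mult_mono) auto
    also have "\<dots> < ?y" using y by simp
    finally have "ln (exp 2) < ln ?y" using y by (subst ln_less_cancel_iff) auto
    then show ?thesis by simp
  qed
  then have s2: "s\<^sup>2 = 2 * ln ?y" "s > 2"
    by (auto simp: s real_less_rsqrt)
  have m0: "m > 0" using m \<open>ln ?y > 2\<close> by (intro gr0I) auto
  define F where "F = {g \<in> ?S. ip d g (a p) \<in> {0..1 / t}}"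
  define G where "G l = {g \<in> ?S. s < \<bar>ip d g (a l)\<bar>}" for l
  define H where "H = {g \<in> ?S. (exp 3 * (real (2 * m) * \<tau>\<^sup>2)) ^ m < tr d (mpow d (contr d E g) (2 * m))}"
  have ev: "F \<in> events" "G l \<in> events" "H \<in> events" for l
    unfolding F_def G_def H_def by measurable
  have unit: "ip d (a l) (a l) = 1" if "l \<in> I" for l
    using orthonormal_onD[OF I(2) that that] by simp
  have t0: "t > 2" using t s2 by simp
  \<comment> \<open>From \<open>sqrt 2 <= 3 / 2\<close> one gets \<open>t <= 3 / 2 * s\<close>,
    which turns the density bound \<open>3 / 10\<close> into \<open>1 / 5\<close>.\<close>
  have "1 / 5 * (1 / s) \<le> 3 / 10 * (1 / t)"
  proof -
    have "sqrt 2 * s \<le> 3 / 2 * s"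
      using s2 by (intro mult_right_mono real_le_lsqrt) (auto simp: power2_eq_square)
    with t have "t \<le> 3 / 2 * s" by simp
    then show ?thesis using s2 t0 by (simp add: field_simps)
  qed
  also have "\<dots> \<le> std_normal_density (1 / t) * (1 / t)"
    using t0 by (intro mult_right_mono std_normal_density_ge) auto
  also have "\<dots> \<le> prob F"
    unfolding F_def using gauss_interval[of "1 / t"] t0 measure_linear_form[OF unit[OF I(3)], of "{0..1 / t}"]
    by (simp add: mult.commute)
  finally have F: "1 / 5 * (1 / s) \<le> prob F" .
  have "prob (\<Union>l\<in>I - {p}. G l) \<le> (\<Sum>l\<in>I - {p}. prob (G l))"
    using I(1) ev by (intro measure_UNION_le) auto
  also have "\<dots> \<le> (\<Sum>l\<in>I - {p}. 1 / (?y * s))"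
  proof (rule sum_mono)
    fix l assume "l \<in> I - {p}"
    then have "prob (G l) \<le> 2 * std_normal_density s / s"
      unfolding G_def using s2 by (intro linear_form_tail unit) auto
    also have "\<dots> \<le> 1 / (?y * s)"
      using s2 y by (intro std_normal_density_le) auto
    finally show "prob (G l) \<le> 1 / (?y * s)" .
  qed
  also have "\<dots> = real (card (I - {p})) * (1 / (?y * s))" by simp
  \<comment> \<open>At most \<open>d\<close> vectors are orthonormal, so the factor 16 inside the
    logarithm defining \<open>s\<close> leaves \<open>1 / 16\<close> after the union bound.\<close>
  also have "\<dots> \<le> real d * (1 / (?y * s))"
    using card_orthonormal_le[OF I(1,2)] card_Diff1_le[of I p] s2 y
    by (intro mult_right_mono) auto
  also have "\<dots> = 1 / 16 * (1 / s)" using \<open>d \<ge> 2\<close> by simp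
  finally have G: "prob (\<Union>l\<in>I - {p}. G l) \<le> 1 / 16 * (1 / s)" .
  have "prob H \<le> real d / exp 3 ^ m"
    unfolding H_def by (rule trace_tail[OF sym bound m0]) auto
  \<comment> \<open>Since \<open>m\<close> is at least \<open>ln ?y\<close>, the constant
    \<open>exp 3\<close> of the threshold yields the third power of \<open>?y\<close>: one factor
    cancels \<open>d\<close>, and the other two dominate \<open>s\<close>.\<close>
  also have "\<dots> \<le> real d / ?y ^ 3"
  proof -
    have "?y ^ 3 = exp (ln ?y) ^ 3" using y by simp
    also have "\<dots> \<le> exp (real m) ^ 3" using m by (intro power_mono) auto
    also have "\<dots> = exp 3 ^ m" by (simp add: exp_of_nat_mult[symmetric] mult.commute)
    finally show ?thesis using y by (intro divide_left_mono) auto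
  qed
  also have "\<dots> = 1 / 16 * (1 / ?y\<^sup>2)"
    using \<open>d \<ge> 2\<close> by (simp add: power2_eq_square power3_eq_cube)
  also have "\<dots> \<le> 1 / 16 * (1 / s)"
  proof -
    have "s\<^sup>2 \<le> ?y\<^sup>2"
    proof -
      have "s\<^sup>2 \<le> 2 * ?y" using s2(1) ln_less_self[of ?y] \<open>d \<ge> 2\<close> by linarith
      also have "\<dots> \<le> ?y * ?y" using y by (intro mult_right_mono) auto
      finally show ?thesis by (simp add: power2_eq_square)
    qed
    then have "s \<le> ?y" by (rule power2_le_imp_le) simp
    also have "\<dots> \<le> ?y\<^sup>2" by (rule self_le_power) (use \<open>d \<ge> 2\<close> in auto)
    finally show ?thesis using s2 y by (intro mult_left_mono divide_left_mono) auto
  qed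
  finally have H: "prob H \<le> 1 / 16 * (1 / s)" .
  let ?B = "good_event d I p a E (1 / t) s m r"
  have "F \<subseteq> ?B \<union> ((\<Union>l\<in>I - {p}. G l) \<union> H)"
    by (auto simp: F_def G_def H_def good_event_def power_mult r not_le)
  then have "prob F \<le> prob (?B \<union> ((\<Union>l\<in>I - {p}. G l) \<union> H))"
    using I(1) ev sets_good_event[OF I(1)] by (intro finite_measure_mono sets.Un sets.finite_UN) auto
  also have "\<dots> \<le> prob ?B + prob ((\<Union>l\<in>I - {p}. G l) \<union> H)"
    using I(1) ev sets_good_event[OF I(1)] by (intro measure_Un_le sets.Un sets.finite_UN) auto
  also have "prob ((\<Union>l\<in>I - {p}. G l) \<union> H) \<le> prob (\<Union>l\<in>I - {p}. G l) + prob H"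
    using I(1) ev by (intro measure_Un_le sets.finite_UN) auto
  finally have "1 / 5 * (1 / s) \<le> prob ?B + (1 / 16 * (1 / s) + 1 / 16 * (1 / s))"
    using F G H by linarith
  moreover have "1 / s > 0" using s2 by simp
  ultimately have "1 / 16 * (1 / s) \<le> prob ?B" by linarith
  then show ?thesis by simp
qed

section \<open>Eigenvector distance and eigenvalue ratio under bounded noise\<close>

context perturbed_diagonal
begin

text \<open>If \<open>e\<close> is at most half of the gap \<open>\<delta> * s / 3\<close>, the
  other half survives and the sine of the angle is at most \<open>54 * (\<tau> / \<delta>)\<close>.
  Otherwise \<open>\<tau> / \<delta>\<close> exceeds \<open>1 / 54\<close> and the same bound is
  trivial. The distance up to sign is at most twice the sine, hence 108.\<close>

lemma top_eigenvector_dist: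
  assumes "d \<ge> 2" "s > 0" "0 < \<delta>" "0 \<le> \<tau>" and t: "(1 + \<delta> / 3) * s \<le> t" and e: "e \<le> 9 * \<tau> * s"
    and b: "b \<in> carrier_vec d" "\<And>i. i < d \<Longrightarrow> b $ i = a p i"
    and v: "top_eigenvector (Matrix.mat d d (\<lambda>(i, j). M i j)) v"
  shows "dist_up_to_sign v b \<le> 108 * (\<tau> / \<delta>)"
proof -
  let ?A = "Matrix.mat d d (\<lambda>(i, j). M i j)"
  define l where "l = top_eigenvalue ?A"
  obtain u lam where eb: "eigenbasis d M u lam" by (rule spectral_theorem[OF M_sym])
  obtain m where "\<And>k. k < d \<Longrightarrow> lam k \<le> lam m" "l = lam m"
    using top_and_second_eigenvalue[OF eb \<open>d \<ge> 2\<close>] unfolding l_def by metis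
  then have l: "t - e \<le> l" using top_ge[OF eb] by simp
  have vd: "v \<in> carrier_vec d" and Av: "?A *\<^sub>v v = l \<cdot>\<^sub>v v" and v1: "euclid_norm v = 1"
    using v by (auto simp: top_eigenvector_def eigenvector_def l_def)
  have norm: "euclid_norm x = sqrt (ip d (\<lambda>i. x $ i) (\<lambda>i. x $ i))" if "x \<in> carrier_vec d" for x
    using that by (auto simp: euclid_norm_def scalar_prod_def ip_def lessThan_atLeast0)
  have vv: "ip d (\<lambda>i. v $ i) (\<lambda>i. v $ i) = 1"
    using v1 norm[OF vd] by simp
  have ev: "mv d M (\<lambda>i. v $ i) i = l * v $ i" if "i < d" for i
  proof -
    have "mv d M (\<lambda>i. v $ i) i = (?A *\<^sub>v v) $ i"
      using that vd by (auto simp: mv_def scalar_prod_def lessThan_atLeast0)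
    then show ?thesis using that vd by (simp add: Av)
  qed
  define c where "c = ip d (\<lambda>i. v $ i) (a p)"
  have c1: "c\<^sup>2 \<le> 1"
    using ip_Cauchy_Schwarz[of d "\<lambda>i. v $ i" "a p"] vv a_p by (simp add: c_def)
  then have "\<bar>c\<bar> \<le> 1" using abs_le_square_iff[of c 1] by simp
  then have "\<bar>c\<bar> * \<bar>c\<bar> \<le> 1 * \<bar>c\<bar>" by (intro mult_right_mono) auto
  then have c2: "c\<^sup>2 \<le> \<bar>c\<bar>" by (simp add: power2_eq_square)
  define q where "q = sqrt (1 - c\<^sup>2)"
  have q: "0 \<le> q" "q \<le> 1" using c1 by (auto simp: q_def)
  have minus: "euclid_norm (v - b) = sqrt (2 - 2 * c)"
  proof -
    have "ip d (\<lambda>i. (v - b) $ i) (\<lambda>i. (v - b) $ i) = ip d (\<lambda>i. v $ i - a p i) (\<lambda>i. v $ i - a p i)"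
      using vd b by (intro ip_cong) auto
    also have "\<dots> = 2 - 2 * c"
      using vv a_p by (simp add: ip_linear c_def ip_commute[of d "a p" "\<lambda>i. v $ i"])
    finally show ?thesis using norm[of "v - b"] vd b by simp
  qed
  have plus: "euclid_norm (v + b) = sqrt (2 + 2 * c)"
  proof -
    have "ip d (\<lambda>i. (v + b) $ i) (\<lambda>i. (v + b) $ i) = ip d (\<lambda>i. v $ i + a p i) (\<lambda>i. v $ i + a p i)"
      using vd b by (intro ip_cong) auto
    also have "\<dots> = 2 + 2 * c"
      using vv a_p by (simp add: ip_linear c_def ip_commute[of d "a p" "\<lambda>i. v $ i"])
    finally show ?thesis using norm[of "v + b"] vd b by simp
  qed
  \<comment> \<open>The better sign has squared distance \<open>2 - 2 * \<bar>c\<bar>\<close>, which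
    \<open>c2\<close> compares with the squared sine.\<close>
  have "dist_up_to_sign v b \<le> sqrt (4 * (1 - c\<^sup>2))"
  proof (cases "c \<ge> 0")
    case True
    then have "2 - 2 * c \<le> 4 * (1 - c\<^sup>2)"
      using c2 c1 by simp
    then show ?thesis by (simp add: dist_up_to_sign_def minus min_le_iff_disj)
  next
    case False
    then have "2 + 2 * c \<le> 4 * (1 - c\<^sup>2)"
      using c2 c1 by simp
    then show ?thesis by (simp add: dist_up_to_sign_def plus min_le_iff_disj)
  qed
  then have dist: "dist_up_to_sign v b \<le> 2 * q"
    unfolding q_def real_sqrt_mult by simp
  have key: "(l - s) * q \<le> e"
    using eigenvector_component_le[OF vv ev] by (simp add: q_def c_def)
  have "q \<le> 54 * (\<tau> / \<delta>)"
  proof (cases "e \<le> \<delta> * s / 6")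
    case True
    have "(\<delta> * s / 6) * q \<le> (l - s) * q"
      using l t True q by (intro mult_right_mono) (simp_all add: algebra_simps)
    with key e have "(\<delta> * s / 6) * q \<le> 9 * \<tau> * s" by linarith
    then have "s * (\<delta> * q) \<le> s * (54 * \<tau>)" by (simp add: algebra_simps)
    then have "\<delta> * q \<le> 54 * \<tau>" using \<open>s > 0\<close> by simp
    then show ?thesis using \<open>0 < \<delta>\<close> by (simp add: field_simps)
  next
    case False
    then have "\<delta> * s / 6 < 9 * \<tau> * s" using e by linarith
    then have "s * \<delta> < s * (54 * \<tau>)" by (simp add: algebra_simps)
    then have "\<delta> < 54 * \<tau>" using \<open>s > 0\<close> by simp
    then have "1 \<le> 54 * (\<tau> / \<delta>)" using \<open>0 < \<delta>\<close> by (simp add: field_simps)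
    then show ?thesis using q by linarith
  qed
  then show ?thesis using dist by simp
qed

text \<open>In \<open>ereal\<close>, \<open>x / 0\<close> is \<open>\<infinity>\<close> for \<open>x > 0\<close> and \<open>0 / 0 = 0\<close>. For large \<open>\<tau>\<close> the claim holds because
  a negative top eigenvalue is bounded in absolute value by the second one, so that the quotient is
  at least \<open>-1\<close>.\<close>

lemma eigenvalue_ratio:
  assumes "d \<ge> 2" "s > 0" "0 \<le> \<delta>" "\<delta> \<le> 1" "0 \<le> \<tau>" and t: "(1 + \<delta> / 3) * s \<le> t" and e: "e \<le> 9 * \<tau> * s"
  shows "ereal (1 + \<delta> / 3 - 108 * \<tau>) \<le>
    ereal (top_eigenvalue (Matrix.mat d d (\<lambda>(i, j). M i j))) /
    ereal (second_abs_eigenvalue (Matrix.mat d d (\<lambda>(i, j). M i j)))"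
proof -
  let ?A = "Matrix.mat d d (\<lambda>(i, j). M i j)"
  define x where "x = top_eigenvalue ?A"
  define y where "y = second_abs_eigenvalue ?A"
  obtain u lam where eb: "eigenbasis d M u lam" by (rule spectral_theorem[OF M_sym])
  obtain m where m: "m < d" "\<And>k. k < d \<Longrightarrow> lam k \<le> lam m" "top_eigenvalue ?A = lam m"
    and second: "second_abs_eigenvalue ?A = Max ((\<lambda>k. \<bar>lam k\<bar>) ` ({..<d} - {m}))"
    using top_and_second_eigenvalue[OF eb \<open>d \<ge> 2\<close>] by metis
  note x = m(3)[folded x_def] and y = second[folded y_def]
  have top: "t - e \<le> x" using top_ge[OF eb m(2)] x by simp
  have ne: "{..<d} - {m} \<noteq> {}"
  proof -
    have "(if m = 0 then 1 else 0) \<in> {..<d} - {m}" using \<open>d \<ge> 2\<close> by auto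
    then show ?thesis by blast
  qed
  then have "y \<in> (\<lambda>k. \<bar>lam k\<bar>) ` ({..<d} - {m})"
    unfolding y by (intro Max_in) auto
  then obtain k where k: "k < d" "k \<noteq> m" "y = \<bar>lam k\<bar>" by auto
  have mu0: "0 \<le> y" using k by simp
  have mu_le: "y \<le> s + e" using other_le[OF eb m(1,2) k(1,2)] k(3) by simp
  have xk: "lam k \<le> x" using m(2) x k by simp
  define r where "r = 1 + \<delta> / 3 - 108 * \<tau>"
  show ?thesis
  \<comment> \<open>Up to this threshold the lower bound for the top eigenvalue is nonnegative;
    beyond it \<open>r\<close> is at most \<open>- 1\<close>.\<close>
  proof (cases "9 * \<tau> \<le> 1")
    case True
    have "s * (9 * \<tau>) \<le> s * (1 + \<delta> / 3)" using True assms by (intro mult_left_mono) auto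
    then have x0: "(1 + \<delta> / 3 - 9 * \<tau>) * s \<le> x" "0 \<le> (1 + \<delta> / 3 - 9 * \<tau>) * s"
      using top t e by (simp_all add: algebra_simps)
    have mus: "y \<le> (1 + 9 * \<tau>) * s" using mu_le e by (simp add: algebra_simps)
    show ?thesis
    proof (cases "y = 0")
      case True
      show ?thesis
      proof (cases "x = 0")
        case True
        \<comment> \<open>The quotient is \<open>0 / 0 = 0\<close> here, and a vanishing top
          eigenvalue forces \<open>r\<close> to be nonpositive.\<close>
        then have "(1 + \<delta> / 3 - 9 * \<tau>) * s \<le> 0" using x0 by simp
        then have "1 + \<delta> / 3 - 9 * \<tau> \<le> 0" using \<open>s > 0\<close> by (simp add: mult_le_0_iff)
        then have "r \<le> 0" using \<open>0 \<le> \<tau>\<close> by (simp add: r_def)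
        then show ?thesis using True \<open>y = 0\<close>
          by (simp add: x_def[symmetric] y_def[symmetric] r_def divide_ereal_def zero_ereal_def[symmetric])
      next
        case False
        then have "x > 0" using x0 by linarith
        then show ?thesis using \<open>y = 0\<close>
          by (simp add: x_def[symmetric] y_def[symmetric] divide_ereal_def)
      qed
    next
      case False
      then have "y > 0" using mu0 by simp
      have "r * y \<le> x"
      proof (cases "r \<le> 0")
        case True
        then have "r * y \<le> 0" using mu0 by (simp add: mult_nonpos_nonneg)
        also have "0 \<le> x" using x0 by linarith
        finally show ?thesis .
      next
        case False
        then have "r * y \<le> r * ((1 + 9 * \<tau>) * s)" using mus by (intro mult_left_mono) auto
        also have "\<dots> = (r * (1 + 9 * \<tau>)) * s" by simp
        also have "\<dots> \<le> (1 + \<delta> / 3 - 9 * \<tau>) * s"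
        proof (rule mult_right_mono)
          \<comment> \<open>The terms linear in \<open>\<tau>\<close> have total coefficient at most
            \<open>- 99 + 3\<close>, below the required \<open>- 9\<close>.\<close>
          have "\<delta> * \<tau> \<le> 1 * \<tau>" using assms by (intro mult_right_mono) auto
          moreover have "0 \<le> \<tau> * \<tau>" by simp
          moreover have "r * (1 + 9 * \<tau>) = 1 + \<delta> / 3 - 99 * \<tau> + 3 * (\<delta> * \<tau>) - 972 * (\<tau> * \<tau>)"
            by (simp add: r_def algebra_simps)
          ultimately show "r * (1 + 9 * \<tau>) \<le> 1 + \<delta> / 3 - 9 * \<tau>" using \<open>0 \<le> \<tau>\<close> by linarith
        qed (use \<open>s > 0\<close> in simp)
        finally show ?thesis using x0 by linarith
      qed
      then have "r \<le> x / y" using \<open>y > 0\<close> by (simp add: pos_le_divide_eq)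
      then show ?thesis using \<open>y > 0\<close>
        by (simp add: x_def[symmetric] y_def[symmetric] r_def)
    qed
  next
    case False
    then have r: "r \<le> - 1" using assms by (simp add: r_def)
    show ?thesis
    proof (cases "x \<ge> 0")
      case True
      have "ereal r \<le> 0" using r by simp
      also have "0 \<le> ereal x / ereal y"
        using True mu0 by (cases "y = 0") (auto simp: divide_ereal_def zero_ereal_def[symmetric])
      finally show ?thesis by (simp add: x_def y_def r_def)
    next
      case False
      then have "- x \<le> y" "y > 0" using xk k(3) by auto
      then have "- 1 \<le> x / y" by (simp add: pos_le_divide_eq)
      then have "r \<le> x / y" using r by simp
      then show ?thesis using \<open>y > 0\<close>
        by (simp add: x_def[symmetric] y_def[symmetric] r_def)
    qed
  qed
qed

end

section \<open>Consequences of the bound on the flattening\<close>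

lemma sum_div_mod: "(\<Sum>l<d * d. f (l div d) (l mod d)) = (\<Sum>j<d. \<Sum>k<d. f j k)" for d :: nat
proof (cases "d = 0")
  case False
  have "(\<Sum>j<d. \<Sum>k<d. f j k) = (\<Sum>(j, k)\<in>{..<d} \<times> {..<d}. f j k)"
    by (rule sum.cartesian_product)
  also have "\<dots> = (\<Sum>l<d * d. f (l div d) (l mod d))"
  proof (rule sum.reindex_bij_witness[where i = "\<lambda>l. (l div d, l mod d)" and j = "\<lambda>(j, k). j * d + k"])
    fix x assume "x \<in> {..<d} \<times> {..<d}"
    then obtain j k where x: "x = (j, k)" "j < d" "k < d" by auto
    have "j * d + k < (j + 1) * d" using x by simp
    also have "\<dots> \<le> d * d" using x by (intro mult_right_mono) auto
    finally show "(case x of (j, k) \<Rightarrow> j * d + k) \<in> {..<d * d}" by (simp add: x)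
  qed (use False in \<open>auto simp: less_mult_imp_div_less\<close>)
  finally show ?thesis by simp
qed simp

text \<open>\<open>Sup\<close> bounds its members only for a set bounded above, so boundedness comes
  first, by Cauchy-Schwarz against the Frobenius norm. The estimate on the unit ball extends to all
  \<open>z\<close> by scaling, and the zero vector gives \<open>0 \<le> \<tau>\<close>.\<close>

lemma flatten_bound:
  fixes E :: tensor3
  assumes "spectral_norm (flatten_1_23 d E) \<le> \<tau>"
  shows "0 \<le> \<tau>"
    and "(\<Sum>i<d. (\<Sum>j<d. \<Sum>k<d. E i j k * z j k)\<^sup>2) \<le> \<tau>\<^sup>2 * (\<Sum>j<d. \<Sum>k<d. (z j k)\<^sup>2)"
proof -
  let ?A = "flatten_1_23 d E"
  let ?S = "{euclid_norm (?A *\<^sub>v x) | x. x \<in> carrier_vec (dim_col ?A) \<and> euclid_norm x \<le> 1}"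
  have dims: "dim_row ?A = d" "dim_col ?A = d * d" by (simp_all add: flatten_1_23_def)
  have norm: "euclid_norm x = sqrt (ip N (\<lambda>i. x $ i) (\<lambda>i. x $ i))" if "x \<in> carrier_vec N" for x N
    using that by (auto simp: euclid_norm_def scalar_prod_def ip_def lessThan_atLeast0)
  define R where "R i l = E i (l div d) (l mod d)" for i l
  have Ax: "(?A *\<^sub>v x) $ i = ip (d * d) (R i) (\<lambda>l. x $ l)" if "x \<in> carrier_vec (d * d)" "i < d" for x i
    using that by (auto simp: flatten_1_23_def scalar_prod_def ip_def lessThan_atLeast0 R_def)
  have Acarr: "?A *\<^sub>v x \<in> carrier_vec d" for x
    using dims(1) by (metis carrier_vec_dim_vec dim_mult_mat_vec)
  have "bdd_above ?S"
  proof (rule bdd_aboveI)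
    fix y assume "y \<in> ?S"
    then obtain x where x: "x \<in> carrier_vec (d * d)" "euclid_norm x \<le> 1" "y = euclid_norm (?A *\<^sub>v x)"
      using dims by auto
    have xx: "ip (d * d) (\<lambda>l. x $ l) (\<lambda>l. x $ l) \<le> 1"
      using x(2) norm[OF x(1)] by simp
    have "y = sqrt (\<Sum>i<d. (ip (d * d) (R i) (\<lambda>l. x $ l))\<^sup>2)"
      unfolding x(3) norm[OF Acarr] using Ax[OF x(1)] by (simp add: ip_def[of d] power2_eq_square)
    also have "\<dots> \<le> sqrt (\<Sum>i<d. ip (d * d) (R i) (R i))"
    proof (intro real_sqrt_le_mono sum_mono)
      fix i
      have "(ip (d * d) (R i) (\<lambda>l. x $ l))\<^sup>2 \<le> ip (d * d) (R i) (R i) * ip (d * d) (\<lambda>l. x $ l) (\<lambda>l. x $ l)"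
        by (rule ip_Cauchy_Schwarz)
      also have "\<dots> \<le> ip (d * d) (R i) (R i) * 1"
        using xx by (intro mult_left_mono ip_self_nonneg)
      finally show "(ip (d * d) (R i) (\<lambda>l. x $ l))\<^sup>2 \<le> ip (d * d) (R i) (R i)" by simp
    qed
    finally show "y \<le> sqrt (\<Sum>i<d. ip (d * d) (R i) (R i))" .
  qed
  then have le: "euclid_norm (?A *\<^sub>v x) \<le> \<tau>" if "x \<in> carrier_vec (d * d)" "euclid_norm x \<le> 1" for x
    using cSup_upper[of "euclid_norm (?A *\<^sub>v x)" ?S] assms that dims unfolding spectral_norm_def
    by fastforce
  define F where "F z i = (\<Sum>j<d. \<Sum>k<d. E i j k * z j k)" for z i
  define N where "N z = (\<Sum>j<d. \<Sum>k<d. (z j k)\<^sup>2 :: real)" for z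
  have unit: "0 \<le> \<tau> \<and> (\<Sum>i<d. (F z i)\<^sup>2) \<le> \<tau>\<^sup>2" if "N z \<le> 1" for z
  proof -
    define x where "x = Matrix.vec (d * d) (\<lambda>l. z (l div d) (l mod d))"
    have xc: "x \<in> carrier_vec (d * d)" by (simp add: x_def)
    have "ip (d * d) (\<lambda>l. x $ l) (\<lambda>l. x $ l) = N z"
      using sum_div_mod[of "\<lambda>j k. (z j k)\<^sup>2" d] by (simp add: ip_def x_def N_def power2_eq_square)
    then have "euclid_norm x \<le> 1" using norm[OF xc] that by simp
    then have A: "euclid_norm (?A *\<^sub>v x) \<le> \<tau>" by (rule le[OF xc])
    have "ip (d * d) (R i) (\<lambda>l. x $ l) = F z i" for i
      using sum_div_mod[of "\<lambda>j k. E i j k * z j k" d] by (simp add: ip_def x_def F_def R_def)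
    then have "euclid_norm (?A *\<^sub>v x) = sqrt (\<Sum>i<d. (F z i)\<^sup>2)"
      unfolding norm[OF Acarr] using Ax[OF xc] by (simp add: ip_def[of d] power2_eq_square)
    with A have *: "sqrt (\<Sum>i<d. (F z i)\<^sup>2) \<le> \<tau>" by simp
    moreover have "0 \<le> sqrt (\<Sum>i<d. (F z i)\<^sup>2)" by (simp add: sum_nonneg)
    ultimately show ?thesis using sqrt_le_D[OF *] by linarith
  qed
  have "N (\<lambda>_ _. 0) \<le> 1" by (simp add: N_def)
  then show "0 \<le> \<tau>" using unit[of "\<lambda>_ _. 0"] by simp
  have N0: "0 \<le> N z" by (simp add: N_def sum_nonneg)
  show "(\<Sum>i<d. (\<Sum>j<d. \<Sum>k<d. E i j k * z j k)\<^sup>2) \<le> \<tau>\<^sup>2 * (\<Sum>j<d. \<Sum>k<d. (z j k)\<^sup>2)"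
    unfolding F_def[symmetric] N_def[symmetric]
  proof (cases "N z = 0")
    case True
    have "(\<Sum>(j, k)\<in>{..<d} \<times> {..<d}. (z j k)\<^sup>2) = 0"
      using True by (simp add: N_def sum.cartesian_product)
    then have "\<forall>x\<in>{..<d} \<times> {..<d}. (case x of (j, k) \<Rightarrow> (z j k)\<^sup>2) = 0"
      by (subst (asm) sum_nonneg_eq_0_iff) auto
    then have "F z i = 0" for i by (auto simp: F_def intro!: sum.neutral)
    then show "(\<Sum>i<d. (F z i)\<^sup>2) \<le> \<tau>\<^sup>2 * N z" using True by simp
  next
    case False
    define c where "c = sqrt (N z)"
    have c: "c > 0" "c\<^sup>2 = N z" using False N0 by (auto simp: c_def)
    have "N (\<lambda>j k. z j k / c) = N z / c\<^sup>2"
      by (simp add: N_def power_divide sum_divide_distrib)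
    then have "(\<Sum>i<d. (F (\<lambda>j k. z j k / c) i)\<^sup>2) \<le> \<tau>\<^sup>2"
      using unit[of "\<lambda>j k. z j k / c"] c by simp
    moreover have "F (\<lambda>j k. z j k / c) i = F z i / c" for i
      by (simp add: F_def sum_divide_distrib)
    ultimately have "(\<Sum>i<d. (F z i)\<^sup>2) / c\<^sup>2 \<le> \<tau>\<^sup>2"
      by (simp add: power_divide sum_divide_distrib)
    then show "(\<Sum>i<d. (F z i)\<^sup>2) \<le> \<tau>\<^sup>2 * N z"
      using c False N0 by (simp add: pos_divide_le_eq less_le)
  qed
qed

text \<open>Duality: let \<open>z\<close> collect the vectors obtained by applying the slices to
  \<open>x\<close>, with squared norm \<open>N\<close>. The flattening applied to \<open>z\<close>
  and paired with \<open>x\<close> returns \<open>N\<close>, so \<open>N^2\<close> is at most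
  \<open>\<tau>^2 * N\<close> times the squared norm of \<open>x\<close>, and one factor
  \<open>N\<close> cancels.\<close>

lemma slices_bound:
  fixes E :: tensor3
  assumes E: "spectral_norm (flatten_1_23 d E) \<le> \<tau>"
    and sym: "\<And>k. k < d \<Longrightarrow> symmetric_on d (\<lambda>i j. E i j k)"
  shows "(\<Sum>k<d. ip d (mv d (\<lambda>i j. E i j k) x) (mv d (\<lambda>i j. E i j k) x)) \<le> \<tau>\<^sup>2 * ip d x x"
proof -
  define z where "z b k = mv d (\<lambda>i j. E i j k) x b" for b k
  define N where "N = (\<Sum>b<d. \<Sum>k<d. (z b k)\<^sup>2)"
  define F where "F i = (\<Sum>b<d. \<Sum>k<d. E i b k * z b k)" for i
  have LHS: "(\<Sum>k<d. ip d (mv d (\<lambda>i j. E i j k) x) (mv d (\<lambda>i j. E i j k) x)) = N"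
    unfolding N_def by (subst sum.swap) (simp add: ip_def z_def power2_eq_square)
  have N0: "0 \<le> N" by (simp add: N_def sum_nonneg)
  have "ip d x F = (\<Sum>i<d. \<Sum>b<d. \<Sum>k<d. z b k * (E i b k * x i))"
    by (simp add: ip_def F_def sum_distrib_left mult_ac)
  also have "\<dots> = (\<Sum>b<d. \<Sum>k<d. \<Sum>i<d. z b k * (E i b k * x i))"
    by (subst sum.swap) (rule sum.cong[OF refl], rule sum.swap)
  \<comment> \<open>Symmetry of the slices swaps the first two modes, so that the sum over
    \<open>i\<close> becomes an entry of \<open>z\<close> again.\<close>
  also have "\<dots> = (\<Sum>b<d. \<Sum>k<d. \<Sum>i<d. z b k * (E b i k * x i))"
    using sym by (intro sum.cong refl) (auto simp: symmetric_on_def)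
  also have "\<dots> = N"
    by (simp add: N_def sum_distrib_left[symmetric] power2_eq_square) (simp add: z_def mv_def)
  finally have "N\<^sup>2 \<le> ip d x x * ip d F F"
    using ip_Cauchy_Schwarz[of d x F] by simp
  also have "\<dots> \<le> ip d x x * (\<tau>\<^sup>2 * N)"
    using flatten_bound(2)[OF E, of z]
    by (intro mult_left_mono ip_self_nonneg) (simp add: ip_def F_def N_def power2_eq_square)
  finally have "N * N \<le> N * (\<tau>\<^sup>2 * ip d x x)"
    by (simp add: power2_eq_square mult_ac)
  then have "N \<le> \<tau>\<^sup>2 * ip d x x"
    using N0 ip_self_nonneg[of d x] by (cases "N = 0") auto
  then show ?thesis unfolding LHS .
qed

text \<open>The test vector is the rank-one matrix \<open>x j * v k\<close>, whose norm is that of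
  \<open>x\<close>. Translating by \<open>t\<close> times a unit vector thus adds at most
  \<open>t * \<tau>\<close> to the noise.\<close>

lemma contr_bound:
  fixes E :: tensor3
  assumes E: "spectral_norm (flatten_1_23 d E) \<le> \<tau>" and v: "ip d v v = 1"
  shows "\<bar>ip d (mv d (contr d E v) x) y\<bar> \<le> \<tau> * sqrt (ip d x x) * sqrt (ip d y y)"
proof -
  have mv: "mv d (contr d E v) x i = (\<Sum>j<d. \<Sum>k<d. E i j k * (x j * v k))" for i
    by (simp add: mv_def contr_def sum_distrib_right sum_distrib_left mult_ac)
  have "(\<Sum>j<d. \<Sum>k<d. (x j * v k)\<^sup>2) = ip d x x * ip d v v"
    unfolding ip_def sum_product by (intro sum.cong refl) (simp add: power2_eq_square mult_ac)
  then have "ip d (mv d (contr d E v) x) (mv d (contr d E v) x) \<le> \<tau>\<^sup>2 * ip d x x"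
    using flatten_bound(2)[OF E, of "\<lambda>j k. x j * v k"] v
    by (simp add: ip_def[of d "mv d (contr d E v) x"] mv power2_eq_square)
  then have "(ip d (mv d (contr d E v) x) y)\<^sup>2 \<le> \<tau>\<^sup>2 * ip d x x * ip d y y"
    using ip_Cauchy_Schwarz[of d "mv d (contr d E v) x" y] ip_self_nonneg[of d y]
    by (meson mult_right_mono order_trans)
  then have "sqrt ((ip d (mv d (contr d E v) x) y)\<^sup>2) \<le> sqrt (\<tau>\<^sup>2 * ip d x x * ip d y y)"
    by (rule real_sqrt_le_mono)
  then show ?thesis
    using flatten_bound(1)[OF E] by (simp add: real_sqrt_mult)
qed

section \<open>The translated event\<close>

text \<open>For \<open>d = 2\<close> the exponent \<open>p\<close> has to be negative, because \<open>ln 2 < 1\<close>.\<close>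

lemma log_factor_absorbed:
  fixes K :: real
  assumes "K \<ge> 1"
  shows "\<exists>C. \<forall>d::nat. d \<ge> 2 \<longrightarrow> (\<exists>p. \<bar>p\<bar> \<le> C \<and> K * sqrt (ln (real d)) \<le> ln (real d) powr p)"
proof -
  \<comment> \<open>\<open>q c\<close> solves
    \<open>ln c powr q c = K * sqrt (ln c)\<close>.\<close>
  define q where "q c = 1 / 2 + ln K / ln (ln c)" for c :: real
  have q: "ln c powr q c = K * sqrt (ln c)" if "ln c > 0" "ln c \<noteq> 1" for c
  proof -
    have "ln (ln c) \<noteq> 0" using that by (simp add: ln_eq_zero_iff)
    then have "ln c powr (ln K / ln (ln c)) = K"
      using that assms by (simp add: powr_def)
    then show ?thesis using that by (simp add: q_def powr_add powr_half_sqrt)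
  qed
  have ln3: "ln (3 :: real) > 1"
  proof -
    have "ln (exp 1) < ln (3 :: real)" using e_less_272 by (subst ln_less_cancel_iff) auto
    then show ?thesis by simp
  qed
  show ?thesis
  proof (rule exI[of _ "max \<bar>q 2\<bar> \<bar>q 3\<bar>"], intro allI impI)
    fix d :: nat assume "d \<ge> 2"
    show "\<exists>p. \<bar>p\<bar> \<le> max \<bar>q 2\<bar> \<bar>q 3\<bar> \<and> K * sqrt (ln (real d)) \<le> ln (real d) powr p"
    proof (cases "d = 2")
      case True
      then show ?thesis using q[of 2] ln_2_less_1 by (intro exI[of _ "q 2"]) auto
    next
      case False
      with \<open>d \<ge> 2\<close> have "d \<ge> 3" by simp
      then have le: "ln 3 \<le> ln (real d)" by simp
      \<comment> \<open>Above \<open>d = 2\<close> the base \<open>ln d\<close> exceeds 1, so the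
        exponent that is exact at 3 suffices for all larger \<open>d\<close> by
        monotonicity.\<close>
      have "K = ln 3 powr (ln K / ln (ln 3))"
        using ln3 assms by (simp add: powr_def)
      also have "\<dots> \<le> ln (real d) powr (ln K / ln (ln 3))"
        using le ln3 assms by (intro powr_mono2) auto
      finally have "K * sqrt (ln (real d)) \<le> ln (real d) powr (ln K / ln (ln 3)) * sqrt (ln (real d))"
        using le ln3 by (intro mult_right_mono) auto
      also have "\<dots> = ln (real d) powr q 3"
        using le ln3 by (simp add: q_def powr_add powr_half_sqrt)
      finally show ?thesis by (intro exI[of _ "q 3"]) auto
    qed
  qed
qed

text \<open>The constant is \<open>49152 = (3 * 256) * (16 * 4)\<close>, from
  \<open>exp 1 <= 3\<close>, \<open>16 powr (1 + \<delta>) <= 256\<close>, the factor 16 of the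
  untranslated event and \<open>s <= 4 * sqrt (ln d)\<close>.\<close>

lemma shifted_event_prob:
  fixes d :: nat and s t \<delta> :: real
  assumes "d \<ge> 2" "0 \<le> \<delta>" "\<delta> \<le> 1"
    and s: "s = sqrt (2 * ln (16 * real d))" and t: "t = sqrt (1 + \<delta>) * s"
  shows "1 / (real d powr (1 + \<delta>) * (49152 * sqrt (ln (real d)))) \<le> exp (- 1 - t\<^sup>2 / 2) * (1 / (16 * s))"
proof -
  let ?y = "16 * real d"
  have d: "ln (real d) > 0" "ln ?y > 0" using \<open>d \<ge> 2\<close> by auto
  have s0: "s > 0" using d by (simp add: s)
  have "t\<^sup>2 / 2 = (1 + \<delta>) * ln ?y"
    using d assms by (simp add: s t power_mult_distrib)
  then have "exp (1 + t\<^sup>2 / 2) = exp 1 * ?y powr (1 + \<delta>)"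
    using \<open>d \<ge> 2\<close> by (simp add: exp_add powr_def)
  also have "\<dots> = exp 1 * (16 powr (1 + \<delta>) * real d powr (1 + \<delta>))"
    by (simp add: powr_mult)
  also have "\<dots> \<le> 3 * (256 * real d powr (1 + \<delta>))"
  proof (intro mult_mono exp_le)
    have "(16 :: real) powr (1 + \<delta>) \<le> 16 powr 2"
      using assms by (intro powr_mono) auto
    then show "(16 :: real) powr (1 + \<delta>) \<le> 256" by simp
  qed auto
  finally have e: "exp (1 + t\<^sup>2 / 2) \<le> 768 * real d powr (1 + \<delta>)" by simp
  have "s \<le> 4 * sqrt (ln (real d))"
  proof -
    have "ln ?y = 4 * ln 2 + ln (real d)"
    proof -
      have "ln (16 :: real) = ln (2 ^ 4)" by simp
      also have "\<dots> = 4 * ln 2" by (subst ln_realpow) auto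
      finally show ?thesis using \<open>d \<ge> 2\<close> by (simp add: ln_mult)
    qed
    moreover have "ln 2 \<le> ln (real d)" using \<open>d \<ge> 2\<close> by simp
    ultimately have "2 * ln ?y \<le> 16 * ln (real d)" using d by linarith
    then have "s \<le> sqrt (16 * ln (real d))" unfolding s by (rule real_sqrt_le_mono)
    then show ?thesis by (simp add: real_sqrt_mult)
  qed
  then have "exp (1 + t\<^sup>2 / 2) * (16 * s) \<le> (768 * real d powr (1 + \<delta>)) * (16 * (4 * sqrt (ln (real d))))"
    using e s0 by (intro mult_mono) auto
  then have "1 / (real d powr (1 + \<delta>) * (49152 * sqrt (ln (real d)))) \<le> 1 / (exp (1 + t\<^sup>2 / 2) * (16 * s))"
    using s0 d \<open>d \<ge> 2\<close> by (intro divide_left_mono) (auto simp: mult_ac)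
  also have "\<dots> = exp (- 1 - t\<^sup>2 / 2) * (1 / (16 * s))"
  proof -
    have "- 1 - t\<^sup>2 / 2 = - (1 + t\<^sup>2 / 2)" by simp
    then show ?thesis by (simp only: exp_minus) (simp add: inverse_eq_divide)
  qed
  finally show ?thesis .
qed

text \<open>Of the constant 9, the untranslated noise takes 7, by
  \<open>24 * (4 * L) <= 49 * (2 * L)\<close>, and the translation takes 2.\<close>

lemma noise_scale:
  assumes L: "L \<ge> 1" and "real m \<le> L + 1" and s: "s = sqrt (2 * L)" and "t \<le> sqrt 2 * s" and "0 \<le> \<tau>"
  shows "sqrt (exp 3 * real (2 * m)) * \<tau> + t * \<tau> \<le> 9 * \<tau> * s"
proof -
  have "exp (3 :: real) = exp 1 ^ 3" by (simp add: exp_of_nat_mult[symmetric])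
  also have "\<dots> \<le> (272 / 100) ^ 3" using e_less_272 by (intro power_mono) auto
  also have "\<dots> \<le> (24 :: real)" by (simp add: power3_eq_cube)
  finally have "exp 3 * real (2 * m) \<le> 24 * (4 * L)"
    using assms by (intro mult_mono) auto
  also have "\<dots> \<le> 7\<^sup>2 * (2 * L)" using L by simp
  finally have "sqrt (exp 3 * real (2 * m)) \<le> 7 * s"
    unfolding s by (metis real_sqrt_abs real_sqrt_le_mono real_sqrt_mult abs_numeral)
  moreover have "t \<le> 2 * s"
  proof -
    have "sqrt 2 * s \<le> 2 * s"
      using L by (intro mult_right_mono real_le_lsqrt) (auto simp: s)
    with assms(4) show ?thesis by linarith
  qed
  ultimately have "sqrt (exp 3 * real (2 * m)) + t \<le> 9 * s" by simp
  from mult_right_mono[OF this \<open>0 \<le> \<tau>\<close>] show ?thesis by (simp add: algebra_simps)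
qed

text \<open>The event is the good event translated by \<open>t * b 1\<close>. The translation raises
  the coefficient along \<open>b 1\<close> by \<open>t\<close>, leaves the others alone by
  orthogonality, and adds at most \<open>t * \<tau>\<close> to the noise.\<close>

lemma exists_good_translate:
  fixes d n :: nat and a :: "nat \<Rightarrow> real Matrix.vec" and T :: tensor3 and \<tau> \<delta> :: real
  assumes "d \<ge> 2" "n \<ge> 1" and a: "orthonormal_family d {1..n} a" and T: "symmetric_tensor3 d T"
    and E: "spectral_norm (flatten_1_23 d (\<lambda>i j k. T i j k - (\<Sum>l=1..n. cube_tensor (a l) i j k))) \<le> \<tau>"
    and \<delta>: "0 \<le> \<delta>" "\<delta> \<le> 1"
  obtains A where "A \<in> sets (std_gaussian d)"
    "1 / (real d powr (1 + \<delta>) * (49152 * sqrt (ln (real d)))) \<le> measure (std_gaussian d) A"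
    "\<forall>g\<in>A. \<delta> > 0 \<longrightarrow> (\<forall>v. top_eigenvector (contract3 d T g) v \<longrightarrow>
       dist_up_to_sign v (a 1) \<le> 108 * (\<tau> / \<delta>))"
    "\<forall>g\<in>A. ereal (1 + \<delta> / 3 - 108 * \<tau>) \<le>
       ereal (top_eigenvalue (contract3 d T g)) / ereal (second_abs_eigenvalue (contract3 d T g))"
proof -
  define F where "F = (\<lambda>i j k. T i j k - (\<Sum>l=1..n. cube_tensor (a l) i j k))"
  define b where "b l = (\<lambda>i. a l $ i)" for l
  let ?I = "{1..n}"
  have p: "1 \<in> ?I" using \<open>n \<ge> 1\<close> by simp
  have carr: "a l \<in> carrier_vec d" if "l \<in> ?I" for l
    using a that by (auto simp: orthonormal_family_def)
  have orth: "orthonormal_on d ?I b"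
    unfolding orthonormal_on_def
  proof (intro ballI)
    fix i j assume ij: "i \<in> ?I" "j \<in> ?I"
    have "ip d (b i) (b j) = a i \<bullet> a j"
      using carr[OF ij(2)] by (auto simp: ip_def b_def scalar_prod_def lessThan_atLeast0)
    then show "ip d (b i) (b j) = (if i = j then 1 else 0)"
      using a ij by (simp add: orthonormal_family_def)
  qed
  have b1: "ip d (b 1) (b 1) = 1" using orthonormal_onD[OF orth p p] by simp
  have F_bound: "spectral_norm (flatten_1_23 d F) \<le> \<tau>" using E by (simp add: F_def)
  have \<tau>: "0 \<le> \<tau>" by (rule flatten_bound(1)[OF F_bound])
  have F_sym: "symmetric_on d (\<lambda>i j. F i j k)" if "k < d" for k
    unfolding symmetric_on_def F_def
  proof (intro allI impI)
    fix i j assume "i < d" "j < d"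
    then have "T i j k = T j i k" using T that unfolding symmetric_tensor3_def by blast
    then show "T i j k - (\<Sum>l=1..n. cube_tensor (a l) i j k) = T j i k - (\<Sum>l=1..n. cube_tensor (a l) j i k)"
      by (simp add: cube_tensor_def mult_ac)
  qed
  define L where "L = ln (16 * real d)"
  define s where "s = sqrt (2 * L)"
  define t where "t = sqrt (1 + \<delta>) * s"
  \<comment> \<open>Large enough to absorb the factor \<open>d\<close> in the trace bound, small
    enough that \<open>sqrt m\<close> is of the order of \<open>s\<close>.\<close>
  define m where "m = nat \<lceil>L\<rceil>"
  define r where "r = sqrt (exp 3 * real (2 * m)) * \<tau>"
  have L1: "L \<ge> 1"
  proof -
    have "ln (exp 1) \<le> L"
      unfolding L_def using \<open>d \<ge> 2\<close> exp_le by (subst ln_le_cancel_iff) auto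
    then show ?thesis by simp
  qed
  then have s0: "s > 0" by (simp add: s_def)
  have m: "L \<le> real m" "real m \<le> L + 1" "m > 0" using L1 by (auto simp: m_def)
  have t_le: "t \<le> sqrt 2 * s"
    unfolding t_def using \<delta> s0 by (intro mult_right_mono) auto
  have t_ge: "(1 + \<delta> / 3) * s \<le> t"
    unfolding t_def
  proof (intro mult_right_mono real_le_rsqrt)
    have "\<delta> * \<delta> \<le> 1 * \<delta>" using \<delta> by (intro mult_right_mono) auto
    moreover have "(1 + \<delta> / 3)\<^sup>2 = 1 + 2 / 3 * \<delta> + \<delta> * \<delta> / 9"
      by (simp add: power2_eq_square algebra_simps)
    ultimately show "(1 + \<delta> / 3)\<^sup>2 \<le> 1 + \<delta>" using \<delta> by linarith
  qed (use s0 in simp)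
  have st: "s \<le> t"
  proof -
    have "1 * s \<le> (1 + \<delta> / 3) * s" using \<delta> s0 by (intro mult_right_mono) auto
    with t_ge show ?thesis by simp
  qed
  then have t0: "t > 0" using s0 by simp
  have e: "r + t * \<tau> \<le> 9 * \<tau> * s"
    unfolding r_def by (rule noise_scale[OF L1 m(2) s_def t_le \<tau>])
  have r0: "0 \<le> r" and r2: "r\<^sup>2 = exp 3 * (real (2 * m) * \<tau>\<^sup>2)"
    using \<tau> by (simp_all add: r_def power_mult_distrib)
  define B where "B = good_event d ?I 1 b F (1 / t) s m r"
  have B: "B \<in> sets (std_gaussian d)" unfolding B_def by (rule sets_good_event) simp
  have PB: "1 / (16 * s) \<le> measure (std_gaussian d) B"
    unfolding B_def
    by (rule good_event_prob[OF _ orth p \<open>d \<ge> 2\<close> F_sym slices_bound[OF F_bound F_sym] _ st t_le _ r2])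
       (use m in \<open>auto simp: s_def L_def\<close>)
  define v where "v = (\<lambda>k. t * b 1 k)"
  \<comment> \<open>Taking the preimage under the opposite translation makes measurability
    immediate.\<close>
  define A where "A = translate d (\<lambda>k. - v k) -` B \<inter> space (std_gaussian d)"
  have A: "A \<in> sets (std_gaussian d)"
    unfolding A_def by (rule measurable_sets[OF measurable_translate B])
  have vv: "ip d v v = t\<^sup>2"
    using b1 by (simp add: v_def ip_linear power2_eq_square)
  have "exp (- 1 - ip d v v / 2) * measure (std_gaussian d) B \<le> measure (std_gaussian d) A"
  proof (rule measure_translate_ge[OF B A])
    fix g assume g: "g \<in> B"
    then have "g \<in> extensional {..<d}"
      by (auto simp: B_def good_event_def space_std_gaussian PiE_def)
    then have "translate d (\<lambda>k. - v k) (translate d v g) = g"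
      by (auto simp: translate_def extensional_def)
    moreover have "translate d v g \<in> space (std_gaussian d)"
      by (auto simp: space_std_gaussian translate_def)
    ultimately show "translate d v g \<in> A" using g by (simp add: A_def)
    \<comment> \<open>The window width \<open>1 / t\<close> is chosen for this: the linear term of
      the Cameron-Martin weight then costs only \<open>exp (- 1)\<close>.\<close>
    have "ip d g (b 1) \<le> 1 / t" using g by (simp add: B_def good_event_def)
    then show "ip d g v \<le> 1" using t0 by (simp add: v_def ip_linear field_simps)
  qed
  moreover have "exp (- 1 - ip d v v / 2) * (1 / (16 * s)) \<le> exp (- 1 - ip d v v / 2) * measure (std_gaussian d) B"
    using PB by (intro mult_left_mono) auto
  ultimately have PA: "1 / (real d powr (1 + \<delta>) * (49152 * sqrt (ln (real d)))) \<le> measure (std_gaussian d) A"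
    using shifted_event_prob[OF \<open>d \<ge> 2\<close> \<delta> s_def[unfolded L_def] t_def] vv by simp
  have key: "(\<delta> > 0 \<longrightarrow> (\<forall>v. top_eigenvector (contract3 d T g) v \<longrightarrow>
             dist_up_to_sign v (a 1) \<le> 108 * (\<tau> / \<delta>))) \<and>
        ereal (1 + \<delta> / 3 - 108 * \<tau>) \<le>
        ereal (top_eigenvalue (contract3 d T g)) / ereal (second_abs_eigenvalue (contract3 d T g))"
    if "g \<in> A" for g
  proof -
    define h where "h = translate d (\<lambda>k. - v k) g"
    have h: "h \<in> B" using that by (simp add: A_def h_def)
    have g_eq: "g k = h k + t * b 1 k" if "k < d" for k
      using that by (simp add: h_def translate_def v_def)
    have ipg: "ip d g x = ip d h x + t * ip d (b 1) x" for x
    proof -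
      have "ip d g x = ip d (\<lambda>k. h k + t * b 1 k) x" by (intro ip_cong) (auto simp: g_eq)
      then show ?thesis by (simp add: ip_linear)
    qed
    have X_eq: "contr d F g i j = contr d F h i j + t * contr d F (b 1) i j" for i j
      by (simp add: contr_def g_eq algebra_simps sum.distrib sum_distrib_left)
    have X_sym: "symmetric_on d (contr d F h)" by (rule symmetric_contr[OF F_sym])
    have M_sym: "symmetric_on d (contr d T g)"
    proof (rule symmetric_contr)
      fix k assume "k < d"
      then show "symmetric_on d (\<lambda>i j. T i j k)"
        using T unfolding symmetric_tensor3_def symmetric_on_def by blast
    qed
    have X_le: "\<bar>ip d (mv d (contr d F g) x) y\<bar> \<le> (r + t * \<tau>) * sqrt (ip d x x) * sqrt (ip d y y)" for x y
    proof -
      have "mv d (contr d F g) x = (\<lambda>i. mv d (contr d F h) x i + t * mv d (contr d F (b 1)) x i)"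
        by (simp add: mv_def X_eq algebra_simps sum.distrib sum_distrib_left)
      then have "ip d (mv d (contr d F g) x) y =
          ip d (mv d (contr d F h) x) y + t * ip d (mv d (contr d F (b 1)) x) y"
        by (simp add: ip_linear)
      then have "\<bar>ip d (mv d (contr d F g) x) y\<bar> \<le> \<bar>ip d (mv d (contr d F h) x) y\<bar> + t * \<bar>ip d (mv d (contr d F (b 1)) x) y\<bar>"
        using t0 abs_triangle_ineq[of "ip d (mv d (contr d F h) x) y" "t * ip d (mv d (contr d F (b 1)) x) y"]
        by (simp add: abs_mult)
      also have "\<dots> \<le> r * sqrt (ip d x x) * sqrt (ip d y y) + t * (\<tau> * sqrt (ip d x x) * sqrt (ip d y y))"
      proof (rule add_mono)
        have "tr d (mpow d (contr d F h) (2 * m)) \<le> r ^ (2 * m)"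
          using h[unfolded B_def good_event_def] by (elim CollectE conjE)
        then show "\<bar>ip d (mv d (contr d F h) x) y\<bar> \<le> r * sqrt (ip d x x) * sqrt (ip d y y)"
          by (rule bilinear_form_le_of_trace[OF X_sym m(3) r0])
        show "t * \<bar>ip d (mv d (contr d F (b 1)) x) y\<bar> \<le> t * (\<tau> * sqrt (ip d x x) * sqrt (ip d y y))"
          using t0 contr_bound[OF F_bound b1] by (intro mult_left_mono) auto
      qed
      finally show ?thesis by (simp add: algebra_simps)
    qed
    \<comment> \<open>The weights are the coefficients of the translated sample \<open>g\<close>;
      the bounds on them are those of \<open>h\<close>, with \<open>t\<close> added along
      \<open>b 1\<close>.\<close>
    interpret perturbed_diagonal d ?I 1 b "\<lambda>l. ip d g (b l)" "contr d F g" "contr d T g" t s "r + t * \<tau>"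
    proof
      fix i j
      have "contr d F g i j = contr d T g i j - (\<Sum>k<d. (\<Sum>l=1..n. b l i * b l j * b l k) * g k)"
        by (simp add: contr_def F_def b_def cube_tensor_def algebra_simps sum_subtractf)
      also have "(\<Sum>k<d. (\<Sum>l=1..n. b l i * b l j * b l k) * g k) = (\<Sum>l=1..n. ip d g (b l) * b l i * b l j)"
        unfolding sum_distrib_right ip_def by (subst sum.swap) (simp only: mult_ac)
      finally show "contr d T g i j = (\<Sum>l\<in>?I. ip d g (b l) * b l i * b l j) + contr d F g i j"
        by simp
    next
      show "t \<le> ip d g (b 1)"
        using h b1 by (simp add: ipg B_def good_event_def)
    next
      fix l assume l: "l \<in> ?I - {1}"
      then have "ip d (b 1) (b l) = 0" using orthonormal_onD[OF orth p, of l] by auto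
      then show "\<bar>ip d g (b l)\<bar> \<le> s"
        using h l by (simp add: ipg B_def good_event_def)
    qed (use orth p M_sym t0 s0 X_le in auto)
    have C: "contract3 d T g = Matrix.mat d d (\<lambda>(i, j). contr d T g i j)"
      by (simp add: contract3_def contr_def)
    show ?thesis
      unfolding C
      using top_eigenvector_dist[OF \<open>d \<ge> 2\<close> s0 _ \<tau> t_ge e carr[OF p]]
        eigenvalue_ratio[OF \<open>d \<ge> 2\<close> s0 \<delta> \<tau> t_ge e]
      by (auto simp: b_def)
  qed
  show ?thesis
    by (rule that[OF A PA]) (use key in simp_all)
qed

theorem theorem10p1:
  shows "\<exists>C>0. \<forall>(d::nat) (n::nat) (a :: nat \<Rightarrow> real Matrix.vec) (T :: tensor3) (\<tau>::real) (\<delta>::real).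
    d \<ge> 2 \<longrightarrow> n \<ge> 1 \<longrightarrow>
    orthonormal_family d {1..n} a \<longrightarrow>
    symmetric_tensor3 d T \<longrightarrow>
    spectral_norm (flatten_1_23 d (\<lambda>i j k. T i j k - (\<Sum>l=1..n. cube_tensor (a l) i j k))) \<le> \<tau> \<longrightarrow>
    0 \<le> \<delta> \<longrightarrow> \<delta> \<le> 1 \<longrightarrow>
    (\<exists>p::real. \<bar>p\<bar> \<le> C \<and>
      (\<exists>A \<in> sets (std_gaussian d).
        measure (std_gaussian d) A \<ge> 1 / (real d powr (1 + \<delta>) * ln (real d) powr p) \<and>
        (\<forall>g\<in>A.
          (\<delta> > 0 \<longrightarrow> (\<forall>v. top_eigenvector (contract3 d T g) v \<longrightarrow>
             dist_up_to_sign v (a 1) \<le> C * (\<tau> / \<delta>))) \<and>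
          ereal (top_eigenvalue (contract3 d T g)) / ereal (second_abs_eigenvalue (contract3 d T g))
            \<ge> ereal (1 + \<delta> / 3 - C * \<tau>))))"
proof -
  obtain C' where C': "\<And>d::nat. d \<ge> 2 \<Longrightarrow> \<exists>p. \<bar>p\<bar> \<le> C' \<and> 49152 * sqrt (ln (real d)) \<le> ln (real d) powr p"
    using log_factor_absorbed[of 49152] by auto
  \<comment> \<open>As \<open>\<tau>\<close> is nonnegative, enlarging the constant only weakens the
    claims.\<close>
  define C where "C = max 108 C'"
  have C: "C > 0" "108 \<le> C" "C' \<le> C" by (auto simp: C_def)
  show ?thesis
  proof (rule exI[of _ C], intro conjI allI impI)
    fix d n :: nat and a :: "nat \<Rightarrow> real Matrix.vec" and T :: tensor3 and \<tau> \<delta> :: real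
    assume d: "2 \<le> d" and n: "1 \<le> n" and a: "orthonormal_family d {1..n} a" and T: "symmetric_tensor3 d T"
      and E: "spectral_norm (flatten_1_23 d (\<lambda>i j k. T i j k - (\<Sum>l=1..n. cube_tensor (a l) i j k))) \<le> \<tau>"
      and \<delta>: "0 \<le> \<delta>" "\<delta> \<le> 1"
    have \<tau>: "0 \<le> \<tau>" by (rule flatten_bound(1)[OF E])
    obtain p where p: "\<bar>p\<bar> \<le> C'" "49152 * sqrt (ln (real d)) \<le> ln (real d) powr p"
      using C'[OF d] by blast
    obtain A where A: "A \<in> sets (std_gaussian d)"
      and PA: "1 / (real d powr (1 + \<delta>) * (49152 * sqrt (ln (real d)))) \<le> measure (std_gaussian d) A"
      and dist: "\<forall>g\<in>A. \<delta> > 0 \<longrightarrow> (\<forall>v. top_eigenvector (contract3 d T g) v \<longrightarrow>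
             dist_up_to_sign v (a 1) \<le> 108 * (\<tau> / \<delta>))"
      and ratio: "\<forall>g\<in>A. ereal (1 + \<delta> / 3 - 108 * \<tau>) \<le>
        ereal (top_eigenvalue (contract3 d T g)) / ereal (second_abs_eigenvalue (contract3 d T g))"
      by (rule exists_good_translate[OF d n a T E \<delta>])
    have ln_pos: "ln (real d) > 0" using d by simp
    have "real d powr (1 + \<delta>) * (49152 * sqrt (ln (real d))) \<le> real d powr (1 + \<delta>) * ln (real d) powr p"
      using p by (intro mult_left_mono) auto
    then have "1 / (real d powr (1 + \<delta>) * ln (real d) powr p) \<le> 1 / (real d powr (1 + \<delta>) * (49152 * sqrt (ln (real d))))"
      by (rule divide_left_mono) (use ln_pos d in simp_all)
    with PA have "1 / (real d powr (1 + \<delta>) * ln (real d) powr p) \<le> measure (std_gaussian d) A"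
      by linarith
    moreover have "dist_up_to_sign v (a 1) \<le> C * (\<tau> / \<delta>)"
      if "g \<in> A" "\<delta> > 0" "top_eigenvector (contract3 d T g) v" for g v
    proof -
      have "108 * (\<tau> / \<delta>) \<le> C * (\<tau> / \<delta>)" using C \<tau> that by (intro mult_right_mono) auto
      with dist[rule_format, OF that] show ?thesis by linarith
    qed
    moreover have "ereal (1 + \<delta> / 3 - C * \<tau>) \<le>
        ereal (top_eigenvalue (contract3 d T g)) / ereal (second_abs_eigenvalue (contract3 d T g))"
      if "g \<in> A" for g
    proof -
      have "108 * \<tau> \<le> C * \<tau>" using C \<tau> by (intro mult_right_mono) auto
      then have "ereal (1 + \<delta> / 3 - C * \<tau>) \<le> ereal (1 + \<delta> / 3 - 108 * \<tau>)" by simp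
      then show ?thesis using ratio[rule_format, OF that] by (rule order_trans)
    qed
    moreover have "\<bar>p\<bar> \<le> C" using p C by simp
    ultimately show "\<exists>p::real. \<bar>p\<bar> \<le> C \<and>
      (\<exists>A \<in> sets (std_gaussian d).
        measure (std_gaussian d) A \<ge> 1 / (real d powr (1 + \<delta>) * ln (real d) powr p) \<and>
        (\<forall>g\<in>A.
          (\<delta> > 0 \<longrightarrow> (\<forall>v. top_eigenvector (contract3 d T g) v \<longrightarrow>
             dist_up_to_sign v (a 1) \<le> C * (\<tau> / \<delta>))) \<and>
          ereal (top_eigenvalue (contract3 d T g)) / ereal (second_abs_eigenvalue (contract3 d T g))
            \<ge> ereal (1 + \<delta> / 3 - C * \<tau>)))"
      using A by (intro exI[of _ p] conjI bexI[of _ A] ballI impI allI)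
  qed (rule C(1))
qed

end
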